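(* There are only finitely many uniformly most reliable graphs of corank $5$. That is, up to isomorphism there are only finitely many simple graphs $G$ such that, for some positive integer $n$, $G$ belongs to $\mathcal{C}_{n,n+4}$ and $G$ is a uniformly most reliable graph in $\mathcal{C}_{n,n+4}$.
   Context: All graphs are finite and undirected. For positive integers $n,m$, $\mathcal{C}_{n,m}$ denotes the class of connected simple graphs on $n$ vertices and $m$ edges. The corank of a graph in $\mathcal{C}_{n,m}$ is $m-n+1$. For a simple graph $G$ and $\rho\in[0,1]$, the reliability $R_G(\rho)$ is the probability that $G$ remains connected when each edge is removed independently with probability $\rho$. A graph $G\in\mathcal{C}_{n,m}$ is a uniformly most reliable graph (UMRG) if $R_G(\rho)\ge R_H(\rho)$ for every $H\in\mathcal{C}_{n,m}$ and every $\rho\in[0,1]$. *)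

theory Defs
  imports "HOL-Probability.Probability"
begin

text \<open>A graph is a pair of its vertex set and its edge set; an undirected edge is the
  two-element set of its endpoints.\<close>

type_synonym 'a ugraph = "'a set \<times> 'a set set"

definition simple_ugraph :: "'a ugraph \<Rightarrow> bool" where
  "simple_ugraph G \<longleftrightarrow>
     finite (fst G) \<and> snd G \<subseteq> {e. e \<subseteq> fst G \<and> card e = 2}"

definition ugraph_adj :: "'a ugraph \<Rightarrow> ('a \<times> 'a) set" where
  "ugraph_adj G = {(u, v). {u, v} \<in> snd G}"

definition ugraph_connected :: "'a ugraph \<Rightarrow> bool" where
  "ugraph_connected G \<longleftrightarrow>
     fst G \<noteq> {} \<and> (\<forall>u\<in>fst G. \<forall>v\<in>fst G. (u, v) \<in> (ugraph_adj G)\<^sup>*)"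

definition conn_graphs :: "nat \<Rightarrow> nat \<Rightarrow> 'a ugraph set" where
  "conn_graphs n m =
     {G. simple_ugraph G \<and> ugraph_connected G \<and> card (fst G) = n \<and> card (snd G) = m}"

text \<open>In a sample \<open>r\<close>, the edge \<open>e\<close> is removed iff \<open>r e\<close> holds; all vertices are kept.
  The value \<open>False\<close> is only the default of \<open>r\<close> outside the edge set.\<close>

definition reliability :: "'a ugraph \<Rightarrow> real \<Rightarrow> real" where
  "reliability G \<rho> =
     measure_pmf.prob (Pi_pmf (snd G) False (\<lambda>_. bernoulli_pmf \<rho>))
       {r. ugraph_connected (fst G, {e \<in> snd G. \<not> r e})}"

text \<open>The competitors \<open>H\<close> have the same vertex type as \<open>G\<close>. Over an infinite vertex type such as
  \<open>nat\<close> every finite graph occurs up to isomorphism, so nothing is lost.\<close>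

definition umrg :: "nat \<Rightarrow> nat \<Rightarrow> 'a ugraph \<Rightarrow> bool" where
  "umrg n m G \<longleftrightarrow> G \<in> conn_graphs n m \<and>
     (\<forall>H \<in> (conn_graphs n m :: 'a ugraph set). \<forall>\<rho>\<in>{0..1}. reliability G \<rho> \<ge> reliability H \<rho>)"

definition ugraph_iso :: "('a ugraph \<times> 'a ugraph) set" where
  "ugraph_iso = {(G, H). simple_ugraph G \<and> simple_ugraph H \<and>
     (\<exists>f. bij_betw f (fst G) (fst H) \<and>
        (\<forall>u\<in>fst G. \<forall>v\<in>fst G. {u, v} \<in> snd G \<longleftrightarrow> {f u, f v} \<in> snd H))}"

end

theory Submission
  imports Defs
begin

text \<open>
  Let \<open>F\<^sub>k\<close> be the number of \<open>k\<close>-sets of edges of \<open>G\<close> whose removal leaves \<open>G\<close> connected, and \<open>m\<close> the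
  number of edges. Letting \<open>\<rho>\<close> tend to 0 shows that a uniformly most reliable graph maximises \<open>F\<^sub>1\<close> and
  then \<open>F\<^sub>2\<close>; letting \<open>\<rho>\<close> tend to 1 shows that it maximises \<open>F\<^sub>5\<close>, the number of spanning trees.
  Maximality of \<open>F\<^sub>1\<close> excludes bridges, and then \<open>F\<^sub>2\<close> misses exactly the pairs of edges in a common
  series class, of which there are at most 12. For large \<open>m\<close>, maximality of \<open>F\<^sub>2\<close> therefore forces 12
  classes of size \<open>m / 12 + O(1)\<close>: the graph is a balanced subdivision of a 3-edge-connected cubic
  graph on 8 vertices. Such a cubic graph has at most 392 spanning trees, the maximum being
  attained by the Wagner graph (the 8-cycle with its four long chords), so \<open>F\<^sub>5\<close> is at most about
  \<open>392 (m / 12)\<^sup>5\<close>. In the Wagner graph, however, the chords are not equivalent to the edges of the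
  cycle, and subdividing them unequally, in the ratio 22 to 19, gives more than \<open>393 (m / 12)\<^sup>5\<close>
  spanning trees. Hence the number of vertices is bounded.
\<close>

section \<open>The reliability polynomial\<close>

text \<open>The bound of 12 classes comes from contraction. Contracting all edges but one of every
  series class leaves \<open>p\<close> vertices and \<open>r \<le> p + 4\<close> edges, and every
  cut has at least three edges. For \<open>p \<ge> 2\<close> this gives
  \<open>3 * p \<le> 2 * r\<close>, hence \<open>r \<le> 12\<close>; equality forces
  \<open>p = 8\<close> and all degrees equal to three.

  Neither end of the interval gives a contradiction alone: the subdivision that wins near 1 loses
  near 0. The gain in \<open>F\<^sub>5\<close> has order \<open>m\<^sup>5\<close>, whereas the
  bounded imbalance that maximality of \<open>F\<^sub>2\<close> still allows changes
  \<open>F\<^sub>5\<close> only by order \<open>m\<^sup>4\<close>. Rough estimates therefore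
  suffice, and the final threshold is not optimised.

  Connectivity is handled through edge cuts: a removal is harmless exactly if it contains no cut of
  a proper part. Cuts are closed under symmetric difference, so edges in series can be exchanged for
  each other. On eight vertices there are only 127 bipartitions to list, which makes the counts for
  concrete graphs computable.\<close>

definition removals :: "'a ugraph \<Rightarrow> nat \<Rightarrow> 'a set set set" where
  "removals G k = {D. D \<subseteq> snd G \<and> card D = k \<and> ugraph_connected (fst G, snd G - D)}"

lemma finite_removals: "finite (snd G) \<Longrightarrow> finite (removals G k)"
  by (simp add: removals_def)

text \<open>Grouping the samples by the number of removed edges gives a polynomial in Bernstein form
  whose coefficients are the numbers \<open>F\<^sub>k\<close>.\<close>

lemma reliability_eq_sum:
  assumes "finite (snd G)" and "\<rho> \<in> {0..1}"
  shows "reliability G \<rho> =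
    (\<Sum>k\<le>card (snd G). real (card (removals G k)) * \<rho> ^ k * (1 - \<rho>) ^ (card (snd G) - k))"
proof -
  let ?E = "snd G"
  let ?p = "Pi_pmf ?E False (\<lambda>_. bernoulli_pmf \<rho>)"
  let ?C = "{D. D \<subseteq> ?E \<and> ugraph_connected (fst G, ?E - D)}"
  let ?w = "\<lambda>D. \<rho> ^ card D * (1 - \<rho>) ^ (card ?E - card D)"
  let ?ind = "\<lambda>D e. e \<in> D"
  have inj: "inj_on ?ind (Pow ?E)"
    by (rule inj_onI) (metis Collect_mem_eq)
  have pmf: "pmf ?p (?ind D) = ?w D" if "D \<subseteq> ?E" for D
  proof -
    have "pmf ?p (?ind D) = (\<Prod>e\<in>?E. pmf (bernoulli_pmf \<rho>) (e \<in> D))"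
      using that assms(1) by (subst pmf_Pi') auto
    also have "\<dots> = (\<Prod>e\<in>?E. if e \<in> D then \<rho> else 1 - \<rho>)"
      using assms(2) by (intro prod.cong) auto
    also have "\<dots> = (\<Prod>e\<in>?E \<inter> D. \<rho>) * (\<Prod>e\<in>?E \<inter> - D. 1 - \<rho>)"
      using assms(1) by (subst prod.If_cases) auto
    also have "\<dots> = (\<Prod>e\<in>D. \<rho>) * (\<Prod>e\<in>?E - D. 1 - \<rho>)"
      using that by (simp add: Int_absorb1 Diff_eq)
    also have "\<dots> = ?w D"
      using that assms(1) by (simp add: card_Diff_subset finite_subset)
    finally show ?thesis .
  qed
  \<comment> \<open>Almost every sample is \<open>False\<close> off the edge set, hence is the
    indicator of the set of removed edges.\<close>
  have "reliability G \<rho> = measure ?p (?ind ` ?C)"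
    unfolding reliability_def
  proof (rule measure_pmf.finite_measure_eq_AE)
    have "r \<in> {r. ugraph_connected (fst G, {e \<in> ?E. \<not> r e})} \<longleftrightarrow> r \<in> ?ind ` ?C"
      if r: "r \<in> set_pmf ?p" for r
    proof -
      have sub: "{e. r e} \<subseteq> ?E"
        using r assms(1) by (auto simp: set_Pi_pmf PiE_dflt_def)
      have eq: "{e \<in> ?E. \<not> r e} = ?E - {e. r e}" by auto
      have "r \<in> ?ind ` ?C \<longleftrightarrow> {e. r e} \<in> ?C"
      proof
        assume "{e. r e} \<in> ?C"
        then show "r \<in> ?ind ` ?C" by (intro image_eqI[of _ _ "{e. r e}"]) auto
      qed auto
      then show ?thesis using sub eq by auto
    qed
    then show "AE r in measure_pmf ?p. (r \<in> {r. ugraph_connected (fst G, {e \<in> ?E. \<not> r e})}) = (r \<in> ?ind ` ?C)"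
      by (simp add: AE_measure_pmf_iff)
  qed auto
  also have "\<dots> = (\<Sum>r\<in>?ind ` ?C. pmf ?p r)"
    using assms(1) by (intro measure_measure_pmf_finite) (auto intro!: finite_imageI)
  also have "\<dots> = (\<Sum>D\<in>?C. pmf ?p (?ind D))"
    by (rule sum.reindex_cong[OF inj_on_subset[OF inj]]) auto
  also have "\<dots> = (\<Sum>D\<in>?C. ?w D)"
    by (intro sum.cong) (auto simp: pmf)
  also have "\<dots> = (\<Sum>k\<le>card ?E. \<Sum>D\<in>{D \<in> ?C. card D = k}. ?w D)"
    using assms(1) by (intro sum.group[symmetric]) (auto intro!: card_mono)
  also have "\<dots> = (\<Sum>k\<le>card ?E. real (card (removals G k)) * \<rho> ^ k * (1 - \<rho>) ^ (card ?E - k))"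
  proof (rule sum.cong)
    fix k
    have "{D \<in> ?C. card D = k} = removals G k" by (auto simp: removals_def)
    moreover have "(\<Sum>D\<in>removals G k. ?w D) = (\<Sum>D\<in>removals G k. \<rho> ^ k * (1 - \<rho>) ^ (card ?E - k))"
      by (intro sum.cong) (auto simp: removals_def)
    ultimately show "(\<Sum>D\<in>{D \<in> ?C. card D = k}. ?w D) =
      real (card (removals G k)) * \<rho> ^ k * (1 - \<rho>) ^ (card ?E - k)" by simp
  qed auto
  finally show ?thesis .
qed

text \<open>The sum is \<open>x ^ j\<close> times a function continuous at 0 with value
  \<open>a j\<close> there. Dividing by the positive factor and letting \<open>x\<close> tend to 0
  from the right preserves the sign.\<close>

lemma bernstein_leading_coeff_nonneg:
  fixes a :: "nat \<Rightarrow> real"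
  assumes nonneg: "\<And>x. 0 < x \<Longrightarrow> x < 1 \<Longrightarrow> 0 \<le> (\<Sum>k\<le>m. a k * x ^ k * (1 - x) ^ (m - k))"
    and "j \<le> m" and zero: "\<And>k. k < j \<Longrightarrow> a k = 0"
  shows "0 \<le> a j"
proof -
  let ?f = "\<lambda>x. \<Sum>k=j..m. a k * x ^ (k - j) * (1 - x) ^ (m - k)"
  have "0 \<le> ?f x" if "0 < x" "x < 1" for x
  proof -
    have "(\<Sum>k\<le>m. a k * x ^ k * (1 - x) ^ (m - k)) = (\<Sum>k=j..m. a k * x ^ k * (1 - x) ^ (m - k))"
      using zero by (intro sum.mono_neutral_right) auto
    also have "\<dots> = x ^ j * ?f x"
      unfolding sum_distrib_left
      by (intro sum.cong) (auto simp: power_add[symmetric] algebra_simps)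
    finally show ?thesis
      using nonneg[OF that] mult_le_cancel_left_pos[of "x ^ j" 0 "?f x"] that by simp
  qed
  then have ev: "\<forall>\<^sub>F x in at_right 0. 0 \<le> ?f x"
    by (auto simp: eventually_at_right_field intro!: exI[of _ 1])
  have "(?f \<longlongrightarrow> ?f 0) (at_right 0)"
    by (intro tendsto_intros)
  then have "0 \<le> ?f 0"
    by (rule tendsto_lowerbound[OF _ ev]) simp
  also have "?f 0 = (\<Sum>k=j..m. if k = j then a k else 0)"
    by (intro sum.cong) auto
  also have "\<dots> = a j" using \<open>j \<le> m\<close> by (subst sum.delta) auto
  finally show ?thesis .
qed

text \<open>In the difference of the two polynomials the first nonzero coefficient decides the
  comparison near 0 and the last one the comparison near 1.\<close>

lemma reliability_le_imp_removals_le: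
  assumes fin: "finite (snd G)" "finite (snd H)"
    and card: "card (snd G) = m" "card (snd H) = m"
    and le: "\<And>\<rho>. \<rho> \<in> {0..1} \<Longrightarrow> reliability H \<rho> \<le> reliability G \<rho>"
    and "j \<le> m"
  shows reliability_le_imp_removals_le_low:
      "(\<And>k. k < j \<Longrightarrow> card (removals G k) = card (removals H k)) \<Longrightarrow>
        card (removals H j) \<le> card (removals G j)"
    and reliability_le_imp_removals_le_high:
      "(\<And>k. j < k \<Longrightarrow> k \<le> m \<Longrightarrow> card (removals G k) = card (removals H k)) \<Longrightarrow>
        card (removals H j) \<le> card (removals G j)"
proof -
  define a where "a k = real (card (removals G k)) - real (card (removals H k))" for k
  have nonneg: "0 \<le> (\<Sum>k\<le>m. a k * x ^ k * (1 - x) ^ (m - k))" if "0 < x" "x < 1" for x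
  proof -
    have "x \<in> {0..1}" using that by auto
    from le[OF this] show ?thesis
      using reliability_eq_sum[OF fin(1) \<open>x \<in> {0..1}\<close>] reliability_eq_sum[OF fin(2) \<open>x \<in> {0..1}\<close>] card
      by (simp add: a_def algebra_simps sum_subtractf)
  qed
  show "card (removals H j) \<le> card (removals G j)"
    if "\<And>k. k < j \<Longrightarrow> card (removals G k) = card (removals H k)"
    using bernstein_leading_coeff_nonneg[of a m j, OF nonneg \<open>j \<le> m\<close>] that by (simp add: a_def)
  \<comment> \<open>Replacing \<open>x\<close> by \<open>1 - x\<close> reverses the order of the
    coefficients, so the end 1 reduces to the end 0.\<close>
  have rev: "0 \<le> (\<Sum>k\<le>m. a (m - k) * x ^ k * (1 - x) ^ (m - k))" if "0 < x" "x < 1" for x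
  proof -
    have "(\<Sum>k\<le>m. a (m - k) * x ^ k * (1 - x) ^ (m - k)) = (\<Sum>k\<le>m. a k * x ^ (m - k) * (1 - x) ^ k)"
      by (rule sum.reindex_bij_witness[of _ "\<lambda>k. m - k" "\<lambda>k. m - k"]) auto
    then show ?thesis using nonneg[of "1 - x"] that by (simp add: algebra_simps)
  qed
  show "card (removals H j) \<le> card (removals G j)"
    if "\<And>k. j < k \<Longrightarrow> k \<le> m \<Longrightarrow> card (removals G k) = card (removals H k)"
    using bernstein_leading_coeff_nonneg[of "\<lambda>k. a (m - k)" m "m - j", OF rev] that \<open>j \<le> m\<close>
    by (force simp: a_def)
qed

section \<open>Edge cuts\<close>

definition edge_cut :: "'a set set \<Rightarrow> 'a set \<Rightarrow> 'a set set" where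
  "edge_cut E S = {e \<in> E. e \<inter> S \<noteq> {} \<and> \<not> e \<subseteq> S}"

definition proper_part :: "'a set \<Rightarrow> 'a set \<Rightarrow> bool" where
  "proper_part V S \<longleftrightarrow> S \<subseteq> V \<and> S \<noteq> {} \<and> S \<noteq> V"

lemma finite_edges: "simple_ugraph G \<Longrightarrow> finite (snd G)"
  by (auto simp: simple_ugraph_def intro: finite_subset[of _ "Pow (fst G)"])

lemma edge_cut_subset: "edge_cut E S \<subseteq> E"
  by (auto simp: edge_cut_def)

lemma edge_cut_Diff: "edge_cut (E - D) S = edge_cut E S - D"
  by (auto simp: edge_cut_def)

lemma doubleton_in_edge_cut_iff: "{u, v} \<in> edge_cut E S \<longleftrightarrow> {u, v} \<in> E \<and> (u \<in> S \<longleftrightarrow> v \<notin> S)"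
  by (auto simp: edge_cut_def)

text \<open>Over the field with two elements the cuts form a vector space. Transitivity of
  \<open>series\<close> and the exchange of edges within a class rest on this.\<close>

lemma edge_cut_sym_diff:
  assumes "simple_ugraph (V, E)"
  shows "edge_cut E ((S - T) \<union> (T - S)) = (edge_cut E S - edge_cut E T) \<union> (edge_cut E T - edge_cut E S)"
proof (rule set_eqI)
  fix e
  show "e \<in> edge_cut E ((S - T) \<union> (T - S)) \<longleftrightarrow> e \<in> (edge_cut E S - edge_cut E T) \<union> (edge_cut E T - edge_cut E S)"
  proof (cases "e \<in> E")
    case True
    then have "card e = 2" using assms by (auto simp: simple_ugraph_def)
    then obtain u v where "e = {u, v}" by (meson card_2_iff)
    then show ?thesis using True by (auto simp: doubleton_in_edge_cut_iff)
  qed (auto simp: edge_cut_def)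
qed

lemma edge_cut_trivial:
  assumes "simple_ugraph (V, E)"
  shows "edge_cut E {} = {}" "edge_cut E V = {}"
  using assms by (auto simp: edge_cut_def simple_ugraph_def)

lemma connected_iff_cut:
  assumes "simple_ugraph (V, E)"
  shows "ugraph_connected (V, E) \<longleftrightarrow> V \<noteq> {} \<and> (\<forall>S. proper_part V S \<longrightarrow> edge_cut E S \<noteq> {})"
proof
  assume conn: "ugraph_connected (V, E)"
  have "edge_cut E S \<noteq> {}" if S: "proper_part V S" for S
  proof
    assume empty: "edge_cut E S = {}"
    from S obtain u v where uv: "u \<in> S" "v \<in> V" "v \<notin> S" by (auto simp: proper_part_def)
    have "(u, v) \<in> (ugraph_adj (V, E))\<^sup>*"
      using conn uv S by (auto simp: ugraph_connected_def proper_part_def)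
    then have "v \<in> S"
    proof induction
      case (step y z)
      then have "{y, z} \<in> E" by (auto simp: ugraph_adj_def)
      then show ?case using step empty doubleton_in_edge_cut_iff[of y z E S] by auto
    qed (use uv in auto)
    then show False using uv by simp
  qed
  then show "V \<noteq> {} \<and> (\<forall>S. proper_part V S \<longrightarrow> edge_cut E S \<noteq> {})"
    using conn by (auto simp: ugraph_connected_def)
next
  assume cuts: "V \<noteq> {} \<and> (\<forall>S. proper_part V S \<longrightarrow> edge_cut E S \<noteq> {})"
  have "(u, v) \<in> (ugraph_adj (V, E))\<^sup>*" if uv: "u \<in> V" "v \<in> V" for u v
  proof (rule ccontr)
    assume "(u, v) \<notin> (ugraph_adj (V, E))\<^sup>*"
    define S where "S = {w \<in> V. (u, w) \<in> (ugraph_adj (V, E))\<^sup>*}"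
    have "u \<in> S" "v \<notin> S" using uv \<open>(u, v) \<notin> _\<close> by (auto simp: S_def)
    then have "proper_part V S" using uv by (auto simp: proper_part_def S_def)
    then obtain e where e: "e \<in> edge_cut E S" using cuts by auto
    then have "card e = 2" "e \<subseteq> V" "e \<in> E" using assms by (auto simp: simple_ugraph_def edge_cut_def)
    moreover obtain x y where "e = {x, y}" "x \<in> S" "y \<notin> S"
      using e \<open>card e = 2\<close> by (auto simp: edge_cut_def card_2_iff)
    ultimately have "(x, y) \<in> ugraph_adj (V, E)" "y \<in> V" by (auto simp: ugraph_adj_def)
    then show False using \<open>x \<in> S\<close> \<open>y \<notin> S\<close> by (auto simp: S_def intro: rtrancl_into_rtrancl)
  qed
  then show "ugraph_connected (V, E)" using cuts by (auto simp: ugraph_connected_def)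
qed

lemma connected_Diff_iff_cut:
  assumes "simple_ugraph (V, E)" "V \<noteq> {}"
  shows "ugraph_connected (V, E - D) \<longleftrightarrow> (\<forall>S. proper_part V S \<longrightarrow> \<not> edge_cut E S \<subseteq> D)"
proof -
  have "simple_ugraph (V, E - D)" using assms by (auto simp: simple_ugraph_def)
  then show ?thesis using assms by (simp add: connected_iff_cut edge_cut_Diff)
qed

text \<open>Start from singletons and, for each edge of \<open>C\<close> in turn, merge the blocks
  of its two ends. A merge costs at most one block, and none if both ends already share a
  block.\<close>

lemma partition_respecting_edges:
  assumes "finite V" "finite C" "\<forall>e\<in>C. e \<subseteq> V \<and> card e = 2"
  shows "\<exists>P. partition_on V P \<and> (\<forall>K\<in>P. edge_cut C K = {}) \<and> card V \<le> card P + card C"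
  using assms(2,3)
proof (induction C rule: finite_induct)
  case empty
  have "partition_on V ((\<lambda>v. {v}) ` V)" by (auto simp: partition_on_def disjoint_def)
  moreover have "card ((\<lambda>v. {v}) ` V) = card V" by (intro card_image) auto
  ultimately show ?case by (intro exI[of _ "(\<lambda>v. {v}) ` V"]) (auto simp: edge_cut_def)
next
  case (insert e C)
  then obtain P where P: "partition_on V P" "\<And>K. K \<in> P \<Longrightarrow> edge_cut C K = {}" "card V \<le> card P + card C"
    by auto
  have finP: "finite P" using P(1) assms(1) finite_elements by blast
  obtain u v where e: "e = {u, v}" "u \<in> V" "v \<in> V" using insert.prems by (auto simp: card_2_iff)
  obtain K L where KL: "K \<in> P" "L \<in> P" "u \<in> K" "v \<in> L" using e P(1) by (auto simp: partition_on_def)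
  define Q where "Q = insert (K \<union> L) (P - {K, L})"
  have disj: "A \<inter> B = {}" if "A \<in> P" "B \<in> P" "A \<noteq> B" for A B
    using P(1) that by (auto simp: partition_on_def disjoint_def)
  have disjKL: "A \<inter> (K \<union> L) = {}" if "A \<in> P - {K, L}" for A
    using that disj[of A K] disj[of A L] KL by auto
  have "\<Union> Q = V"
    using KL P(1) by (auto simp: Q_def partition_on_def)
  moreover have "disjoint Q"
    unfolding disjoint_def Q_def using disj disjKL by (auto simp: Int_commute)
  moreover have "{} \<notin> Q"
    using P(1) KL by (auto simp: Q_def partition_on_def)
  ultimately have "partition_on V Q" by (simp add: partition_on_def)
  moreover have "edge_cut (insert e C) M = {}" if "M \<in> Q" for M
  proof -
    have "edge_cut C M = {}"
    proof (cases "M = K \<union> L")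
      case True
      then show ?thesis using P(2)[OF KL(1)] P(2)[OF KL(2)] by (auto simp: edge_cut_def)
    qed (use that P(2) in \<open>auto simp: Q_def\<close>)
    moreover have "u \<in> M \<longleftrightarrow> v \<in> M"
      using that KL disjKL[of M] by (auto simp: Q_def)
    ultimately show ?thesis unfolding edge_cut_def e by auto
  qed
  moreover have "card V \<le> card Q + card (insert e C)"
  proof -
    have "K \<union> L \<notin> P - {K, L}"
    proof
      assume "K \<union> L \<in> P - {K, L}"
      then have "(K \<union> L) \<inter> K = {}" using disj KL by auto
      then show False using KL by auto
    qed
    then have "card Q = Suc (card (P - {K, L}))" using finP by (simp add: Q_def)
    moreover have "card P \<le> card (P - {K, L}) + 2"
      using diff_card_le_card_Diff[of "{K, L}" P] card_insert_le_m1[of 2 "{L}" K] by simp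
    ultimately show ?thesis using P(3) insert.hyps by simp
  qed
  ultimately show ?case by blast
qed

text \<open>Merging along all edges of a connected graph can only end with the single block
  \<open>V\<close>.\<close>

lemma connected_imp_card_edges:
  assumes "simple_ugraph (V, E)" "ugraph_connected (V, E)"
  shows "card V \<le> Suc (card E)"
proof -
  have "finite V" "finite E"
    using assms(1) finite_edges[OF assms(1)] by (auto simp: simple_ugraph_def)
  then obtain P where P: "partition_on V P" "\<And>K. K \<in> P \<Longrightarrow> edge_cut E K = {}" "card V \<le> card P + card E"
    using partition_respecting_edges[of V E] assms(1) unfolding simple_ugraph_def by fastforce
  have "K = V" if "K \<in> P" for K
  proof -
    have "\<not> proper_part V K" using P(2)[OF that] assms connected_iff_cut by blast
    then show ?thesis using that P(1) by (auto simp: proper_part_def partition_on_def)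
  qed
  then have "P \<subseteq> {V}" by auto
  then have "card P \<le> 1" using card_mono[of "{V}" P] by auto
  then show ?thesis using P(3) by simp
qed

text \<open>More than five removals leave fewer than \<open>n - 1\<close> edges. All coefficients
  beyond index 5 thus vanish, which makes 5 the index to compare near 1.\<close>

lemma removals_eq_empty:
  assumes "G \<in> conn_graphs n (n + 4)" "5 < k"
  shows "removals G k = {}"
proof -
  obtain V E where G: "G = (V, E)" by (cases G)
  have s: "simple_ugraph (V, E)" "card V = n" "card E = n + 4" "finite E"
    using assms G finite_edges[of "(V, E)"] by (auto simp: conn_graphs_def)
  have False if D: "D \<subseteq> E" "card D = k" "ugraph_connected (V, E - D)" for D
  proof -
    have "simple_ugraph (V, E - D)" using s by (auto simp: simple_ugraph_def)
    from connected_imp_card_edges[OF this D(3)] have "n \<le> Suc (card (E - D))" using s by simp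
    moreover have "card (E - D) = n + 4 - k" using D s by (simp add: card_Diff_subset finite_subset)
    moreover have "k \<le> n + 4" using card_mono[OF s(4) D(1)] s D by simp
    ultimately show False using assms(2) by linarith
  qed
  then show ?thesis by (auto simp: removals_def G)
qed

definition three_connected_cubic :: "'a set \<Rightarrow> 'a set set \<Rightarrow> bool" where
  "three_connected_cubic V E \<longleftrightarrow> simple_ugraph (V, E) \<and> (\<forall>v\<in>V. card {e \<in> E. v \<in> e} = 3) \<and>
     (\<forall>S. proper_part V S \<longrightarrow> 3 \<le> card (edge_cut E S))"

section \<open>Series classes\<close>

text \<open>A transversal \<open>D\<close> corresponds to the function that sends \<open>i\<close>
  to the element of \<open>D\<close> with colour \<open>i\<close>, so the transversals are counted
  by a dependent product.\<close>

lemma card_transversals: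
  assumes "finite E" "finite B"
  shows "card {D. D \<subseteq> E \<and> inj_on c D \<and> c ` D = B} = (\<Prod>i\<in>B. card {e \<in> E. c e = i})"
proof -
  let ?F = "PiE B (\<lambda>i. {e \<in> E. c e = i})"
  have val: "f i \<in> E" "c (f i) = i" if "f \<in> ?F" "i \<in> B" for f i
    using that by (auto simp: PiE_iff)
  have inj: "inj_on (\<lambda>f. f ` B) ?F"
  proof (rule inj_onI)
    fix f g assume fg: "f \<in> ?F" "g \<in> ?F" "f ` B = g ` B"
    show "f = g"
    proof (rule PiE_ext[OF fg(1,2)])
      fix i assume i: "i \<in> B"
      then obtain j where "j \<in> B" "f i = g j" using fg(3) by blast
      then show "f i = g i" using val fg i by metis
    qed
  qed
  have img: "(\<lambda>f. f ` B) ` ?F = {D. D \<subseteq> E \<and> inj_on c D \<and> c ` D = B}"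
  proof (intro set_eqI iffI)
    fix D assume "D \<in> (\<lambda>f. f ` B) ` ?F"
    then obtain f where f: "f \<in> ?F" "D = f ` B" by auto
    have "inj_on c D" unfolding f(2) using val[OF f(1)] by (auto intro!: inj_onI)
    moreover have "c ` D = B" unfolding f(2) image_image using val[OF f(1)] by simp
    ultimately show "D \<in> {D. D \<subseteq> E \<and> inj_on c D \<and> c ` D = B}" using val[OF f(1)] f(2) by auto
  next
    fix D assume "D \<in> {D. D \<subseteq> E \<and> inj_on c D \<and> c ` D = B}"
    then have D: "D \<subseteq> E" "inj_on c D" "c ` D = B" by auto
    let ?f = "restrict (inv_into D c) B"
    have "inv_into D c i \<in> D" "c (inv_into D c i) = i" if "i \<in> B" for i
      using that D(3) by (auto simp: inv_into_into f_inv_into_f)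
    then have "?f \<in> ?F" using D(1) by auto
    moreover have "?f ` B = D" unfolding image_restrict_eq D(3)[symmetric]
      by (rule inv_into_image_cancel[OF D(2)]) simp
    ultimately show "D \<in> (\<lambda>f. f ` B) ` ?F" by (auto intro!: image_eqI[of _ _ ?f])
  qed
  show ?thesis using card_image[OF inj] assms(2) unfolding img by (simp add: card_PiE)
qed

lemma card_transversals_of_family:
  assumes "finite E" "finite F" "\<And>B. B \<in> F \<Longrightarrow> finite B"
  shows "card {D. D \<subseteq> E \<and> inj_on c D \<and> c ` D \<in> F} = (\<Sum>B\<in>F. \<Prod>i\<in>B. card {e \<in> E. c e = i})"
proof -
  have "{D. D \<subseteq> E \<and> inj_on c D \<and> c ` D \<in> F} = (\<Union>B\<in>F. {D. D \<subseteq> E \<and> inj_on c D \<and> c ` D = B})"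
    by auto
  also have "card \<dots> = (\<Sum>B\<in>F. card {D. D \<subseteq> E \<and> inj_on c D \<and> c ` D = B})"
    using assms by (intro card_UN_disjoint) (auto simp: finite_subset[of _ "Pow E"])
  also have "\<dots> = (\<Sum>B\<in>F. \<Prod>i\<in>B. card {e \<in> E. c e = i})"
    using assms by (intro sum.cong card_transversals) auto
  finally show ?thesis .
qed

text \<open>For a fixed total, more pairs of edges from different classes means a smaller sum of
  squares. This turns the comparison of \<open>F\<^sub>2\<close> into a statement about
  balance.\<close>

lemma square_of_sum_eq:
  fixes s :: "'a \<Rightarrow> nat"
  assumes "finite I"
  shows "(\<Sum>i\<in>I. s i)\<^sup>2 = (\<Sum>i\<in>I. (s i)\<^sup>2) + 2 * (\<Sum>B | B \<subseteq> I \<and> card B = 2. \<Prod>i\<in>B. s i)"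
  using assms
proof (induction I rule: finite_induct)
  case empty
  have "{B. B \<subseteq> {} \<and> card B = 2} = {}" by auto
  then show ?case by simp
next
  case (insert x I)
  have split: "{B. B \<subseteq> insert x I \<and> card B = 2} = {B. B \<subseteq> I \<and> card B = 2} \<union> (\<lambda>y. {x, y}) ` I"
  proof (intro set_eqI iffI)
    fix B assume B: "B \<in> {B. B \<subseteq> insert x I \<and> card B = 2}"
    then obtain y z where "B = {y, z}" "y \<noteq> z" by (auto simp: card_2_iff)
    then show "B \<in> {B. B \<subseteq> I \<and> card B = 2} \<union> (\<lambda>y. {x, y}) ` I" using B by auto
  qed (use insert.hyps in \<open>auto simp: card_insert_if\<close>)
  have "(\<Sum>B | B \<subseteq> insert x I \<and> card B = 2. \<Prod>i\<in>B. s i) =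
    (\<Sum>B | B \<subseteq> I \<and> card B = 2. \<Prod>i\<in>B. s i) + (\<Sum>B\<in>(\<lambda>y. {x, y}) ` I. \<Prod>i\<in>B. s i)"
    unfolding split using insert.hyps by (intro sum.union_disjoint) auto
  also have "(\<Sum>B\<in>(\<lambda>y. {x, y}) ` I. \<Prod>i\<in>B. s i) = (\<Sum>y\<in>I. s x * s y)"
    by (rule sum.reindex_cong[of "\<lambda>y. {x, y}"])
      (use insert.hyps in \<open>auto intro!: inj_onI simp: doubleton_eq_iff prod.insert_if\<close>)
  also have "\<dots> = s x * (\<Sum>y\<in>I. s y)" by (simp add: sum_distrib_left)
  finally show ?case using insert by (simp add: power2_eq_square algebra_simps)
qed

section \<open>Cut pairs in a bridgeless graph\<close>

locale bridgeless_graph =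
  fixes V :: "'a set" and E :: "'a set set"
  assumes simple: "simple_ugraph (V, E)" and nonempty: "V \<noteq> {}"
    and bridgeless: "\<And>S. proper_part V S \<Longrightarrow> 2 \<le> card (edge_cut E S)"
begin

lemma finite_E: "finite E"
  using finite_edges[OF simple] by simp

lemma finite_V: "finite V"
  using simple by (simp add: simple_ugraph_def)

lemma edge_cases:
  assumes "e \<in> E"
  obtains u v where "e = {u, v}" "u \<noteq> v" "u \<in> V" "v \<in> V"
  using assms simple by (force simp: simple_ugraph_def card_2_iff)

lemma edge_cut_sum:
  assumes "S \<subseteq> V" "T \<subseteq> V"
  obtains U where "U \<subseteq> V" "edge_cut E U = (edge_cut E S - edge_cut E T) \<union> (edge_cut E T - edge_cut E S)"
  using assms edge_cut_sym_diff[OF simple, of S T] by (metis Diff_subset Un_least subset_trans)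

lemma proper_part_iff:
  assumes "S \<subseteq> V" shows "proper_part V S \<longleftrightarrow> edge_cut E S \<noteq> {}"
  using assms bridgeless[of S] edge_cut_trivial[OF simple]
  by (metis card.empty not_numeral_le_zero proper_part_def)

definition series :: "('a set \<times> 'a set) set" where
  "series = {(e, f). e \<in> E \<and> f \<in> E \<and> (e = f \<or> (\<exists>S\<subseteq>V. edge_cut E S = {e, f}))}"

text \<open>For transitivity, the symmetric difference of the cuts \<open>{e, f}\<close> and
  \<open>{f, g}\<close> is the cut \<open>{e, g}\<close>.\<close>

lemma equiv_series: "equiv E series"
proof (rule equivI)
  show "series \<subseteq> E \<times> E" by (auto simp: series_def)
  show "refl_on E series" by (auto simp: refl_on_def series_def)
  show "sym series" by (auto simp: sym_def series_def insert_commute)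
  show "trans series"
  proof (rule transI)
    fix e f g assume *: "(e, f) \<in> series" "(f, g) \<in> series"
    show "(e, g) \<in> series"
    proof (cases "e = f \<or> f = g \<or> e = g")
      case False
      then obtain S T where "S \<subseteq> V" "T \<subseteq> V" "edge_cut E S = {e, f}" "edge_cut E T = {f, g}"
        using * by (auto simp: series_def)
      moreover obtain U where "U \<subseteq> V" "edge_cut E U = ({e, f} - {f, g}) \<union> ({f, g} - {e, f})"
        using edge_cut_sum[of S T] calculation by metis
      moreover have "({e, f} - {f, g}) \<union> ({f, g} - {e, f}) = {e, g}" using False by auto
      ultimately show ?thesis using * by (auto simp: series_def)
    qed (use * in \<open>auto simp: series_def\<close>)
  qed
qed

text \<open>The choice depends only on the set of edges in series with \<open>e\<close>, so it is
  constant on each class.\<close>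

definition rep :: "'a set \<Rightarrow> 'a set" where
  "rep e = (SOME f. (e, f) \<in> series)"

lemma rep_series: "e \<in> E \<Longrightarrow> (e, rep e) \<in> series"
  unfolding rep_def by (rule someI[of _ e]) (simp add: series_def)

lemma rep_in_E: "e \<in> E \<Longrightarrow> rep e \<in> E"
  using rep_series by (auto simp: series_def)

lemma rep_eq_iff:
  assumes "e \<in> E" "f \<in> E"
  shows "rep e = rep f \<longleftrightarrow> (e, f) \<in> series"
proof
  assume "rep e = rep f"
  then have "(e, rep e) \<in> series" "(rep e, f) \<in> series"
    using rep_series[OF assms(1)] rep_series[OF assms(2)] equiv_series by (auto simp: equiv_def sym_def)
  then show "(e, f) \<in> series" using equiv_series by (auto simp: equiv_def dest: transD)
next
  assume "(e, f) \<in> series"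
  then have "(e, g) \<in> series \<longleftrightarrow> (f, g) \<in> series" for g
    using equiv_series by (meson equiv_def symD transD)
  then show "rep e = rep f" by (simp add: rep_def)
qed

lemma rep_rep: "e \<in> E \<Longrightarrow> rep (rep e) = rep e"
  using rep_eq_iff[of "rep e" e] rep_series rep_in_E equiv_series by (auto simp: equiv_def sym_def)

lemma rep_on_reps: "r \<in> rep ` E \<Longrightarrow> rep r = r"
  using rep_rep by auto

text \<open>The representatives in the cut are exchanged one at a time for members of
  \<open>D\<close> in the same class, by adding the two-edge cut that each pair forms. The size is
  tracked because it shows that the lifted cut is nonempty, hence that \<open>T\<close> is a proper
  part.\<close>

lemma lift_edge_cut:
  assumes S: "S \<subseteq> V" "edge_cut E S \<subseteq> rep ` D" and D: "D \<subseteq> E"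
  shows "\<exists>T\<subseteq>V. edge_cut E T \<subseteq> D \<and> card (edge_cut E T) = card (edge_cut E S)"
proof -
  have "\<forall>r\<in>edge_cut E S. \<exists>e\<in>D. rep e = r" using S(2) by (auto simp: subset_iff image_iff)
  then obtain d where d: "\<And>r. r \<in> edge_cut E S \<Longrightarrow> d r \<in> D" "\<And>r. r \<in> edge_cut E S \<Longrightarrow> rep (d r) = r"
    by metis
  have rep_r: "rep r = r" if "r \<in> edge_cut E S" for r
    using that S(2) D rep_rep by (auto simp: subset_iff image_iff)
  have fin: "finite (edge_cut E S)"
    by (rule finite_subset[OF edge_cut_subset finite_E])
  \<comment> \<open>\<open>A\<close> consists of the representatives that have been exchanged so
    far.\<close>
  have "\<exists>T\<subseteq>V. edge_cut E T = (edge_cut E S - A) \<union> d ` A" if "A \<subseteq> edge_cut E S" for A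
    using finite_subset[OF that fin] that
  proof (induction A rule: finite_induct)
    case empty
    then show ?case using S(1) by auto
  next
    case (insert a A)
    then obtain T where T: "T \<subseteq> V" "edge_cut E T = (edge_cut E S - A) \<union> d ` A" by auto
    have a: "a \<in> edge_cut E S" using insert.prems by simp
    show ?case
    proof (cases "d a = a")
      case True
      then have "edge_cut E T = (edge_cut E S - insert a A) \<union> d ` insert a A"
        using T(2) a insert.hyps by auto
      then show ?thesis using T(1) by blast
    next
      case False
      have "(a, d a) \<in> series"
        using rep_eq_iff[of a "d a"] a d D rep_r edge_cut_subset[of E S] by (metis subsetD)
      then obtain U where U: "U \<subseteq> V" "edge_cut E U = {a, d a}" using False by (auto simp: series_def)
      obtain W where W: "W \<subseteq> V"
        "edge_cut E W = (edge_cut E T - {a, d a}) \<union> ({a, d a} - edge_cut E T)"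
        using edge_cut_sum[OF T(1) U(1)] U(2) by metis
      \<comment> \<open>Adding \<open>{a, d a}\<close> exchanges the two edges only if
        \<open>a\<close> lies in the current cut and \<open>d a\<close> does not.\<close>
      have "a \<in> edge_cut E T" using T(2) a insert.hyps by auto
      moreover have "d a \<notin> edge_cut E T"
      proof
        assume "d a \<in> edge_cut E T"
        then consider "d a \<in> edge_cut E S" | b where "b \<in> A" "d a = d b" using T(2) by auto
        then show False
        proof cases
          case 1
          then show False using rep_r[OF 1] d(2)[OF a] False by simp
        next
          case 2
          then have "b \<in> edge_cut E S" using insert.prems by auto
          then have "a = b" using d(2) a 2 by metis
          then show False using 2 insert.hyps by simp
        qed
      qed
      moreover have "a \<notin> d ` A"
      proof
        assume "a \<in> d ` A"
        then obtain b where b: "b \<in> A" "a = d b" by auto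
        then have "rep a = b" using d(2) insert.prems by auto
        then show False using rep_r[OF a] b insert.hyps by simp
      qed
      ultimately have "edge_cut E W = (edge_cut E S - insert a A) \<union> d ` insert a A"
        using W(2) T(2) by auto
      then show ?thesis using W(1) by blast
    qed
  qed
  from this[of "edge_cut E S"] obtain T where T: "T \<subseteq> V" "edge_cut E T = d ` edge_cut E S" by auto
  moreover have "inj_on d (edge_cut E S)" using d(2) by (metis inj_onI)
  ultimately show ?thesis using d(1) by (intro exI[of _ T]) (auto simp: card_image)
qed

text \<open>Two edges of \<open>D\<close> in one class would form a cut inside \<open>D\<close>, and
  a cut among the representatives would lift to a cut inside \<open>D\<close>.\<close>

lemma removals_rep:
  assumes "D \<in> removals (V, E) k"
  shows "inj_on rep D" "rep ` D \<in> removals (V, E) k"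
proof -
  have D: "D \<subseteq> E" "card D = k" and noncut: "\<And>S. proper_part V S \<Longrightarrow> \<not> edge_cut E S \<subseteq> D"
    using assms simple nonempty by (auto simp: removals_def connected_Diff_iff_cut)
  show inj: "inj_on rep D"
  proof (rule inj_onI, rule ccontr)
    fix e f assume ef: "e \<in> D" "f \<in> D" "rep e = rep f" "e \<noteq> f"
    then obtain S where "S \<subseteq> V" "edge_cut E S = {e, f}"
      using rep_eq_iff[of e f] D by (auto simp: series_def)
    then show False using noncut[of S] proper_part_iff[of S] ef by auto
  qed
  have "\<not> edge_cut E S \<subseteq> rep ` D" if S: "proper_part V S" for S
  proof
    assume sub: "edge_cut E S \<subseteq> rep ` D"
    have "S \<subseteq> V" using S by (simp add: proper_part_def)
    from lift_edge_cut[OF this sub D(1)] obtain T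
      where T: "T \<subseteq> V" "edge_cut E T \<subseteq> D" "card (edge_cut E T) = card (edge_cut E S)" by auto
    then have "edge_cut E T \<noteq> {}" using bridgeless[OF S] by auto
    then show False using noncut[of T] proper_part_iff T by auto
  qed
  then have "ugraph_connected (V, E - rep ` D)"
    using simple nonempty by (simp add: connected_Diff_iff_cut)
  moreover have "rep ` D \<subseteq> E" using D(1) rep_in_E by auto
  moreover have "card (rep ` D) = k" using inj D(2) by (simp add: card_image)
  ultimately show "rep ` D \<in> removals (V, E) k" by (simp add: removals_def)
qed

definition class_size :: "'a set \<Rightarrow> nat" where
  "class_size r = card {e \<in> E. rep e = r}"

lemma sum_class_size: "(\<Sum>r\<in>rep ` E. class_size r) = card E"
proof -
  have "card E = (\<Sum>e\<in>E. 1)" by simp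
  also have "\<dots> = (\<Sum>r\<in>rep ` E. \<Sum>e\<in>{e \<in> E. rep e = r}. 1)"
    using finite_E by (intro sum.group[symmetric]) auto
  finally show ?thesis by (simp add: class_size_def)
qed

text \<open>Every removal is a transversal of the classes whose representatives form its image, and
  this image is again a removal.\<close>

lemma card_removals_le:
  "card (removals (V, E) k) \<le> (\<Sum>B | B \<in> removals (V, E) k \<and> B \<subseteq> rep ` E. \<Prod>r\<in>B. class_size r)"
proof -
  let ?F = "{B. B \<in> removals (V, E) k \<and> B \<subseteq> rep ` E}"
  have finF: "finite ?F" using finite_removals[of "(V, E)"] finite_E by simp
  have "removals (V, E) k \<subseteq> {D. D \<subseteq> E \<and> inj_on rep D \<and> rep ` D \<in> ?F}"
    using removals_rep by (auto simp: removals_def)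
  then have "card (removals (V, E) k) \<le> card {D. D \<subseteq> E \<and> inj_on rep D \<and> rep ` D \<in> ?F}"
    using finite_E by (intro card_mono) auto
  also have "\<dots> = (\<Sum>B\<in>?F. \<Prod>i\<in>B. card {e \<in> E. rep e = i})"
    using finF finite_E by (intro card_transversals_of_family) (auto intro: finite_subset)
  finally show ?thesis by (simp add: class_size_def)
qed

end

section \<open>The cubic base graph\<close>

context bridgeless_graph
begin

text \<open>Two representatives that form a cut would be in series and hence equal.\<close>

lemma card_edge_cut_of_reps:
  assumes "proper_part V S" "edge_cut E S \<subseteq> rep ` E"
  shows "3 \<le> card (edge_cut E S)"
proof (rule ccontr)
  assume "\<not> 3 \<le> card (edge_cut E S)"
  then have "card (edge_cut E S) = 2" using bridgeless[OF assms(1)] by simp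
  then obtain e f where ef: "edge_cut E S = {e, f}" "e \<noteq> f" by (auto simp: card_2_iff)
  then have "(e, f) \<in> series"
    using assms(1) edge_cut_subset[of E S] by (auto simp: series_def proper_part_def)
  then have "rep e = rep f" using rep_eq_iff by (auto simp: series_def)
  moreover have "e \<in> rep ` E" "f \<in> rep ` E" using ef(1) assms(2) by auto
  ultimately show False using ef(2) rep_on_reps by metis
qed

text \<open>Contracting all edges but one of every series class gives a 3-edge-connected multigraph.
  The blocks of the partition \<open>P\<close> play the role of its vertices; they need not be connected,
  since only their number and their edge cuts enter.\<close>

lemma partition_by_nonreps:
  obtains P where "partition_on V P" "card V \<le> card P + (card E - card (rep ` E))"
    "\<And>X. X \<subseteq> P \<Longrightarrow> edge_cut E (\<Union>X) \<subseteq> rep ` E"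
proof -
  have fin: "finite (E - rep ` E)" using finite_E by simp
  have "\<forall>e\<in>E - rep ` E. e \<subseteq> V \<and> card e = 2" using simple by (auto simp: simple_ugraph_def)
  from partition_respecting_edges[OF finite_V fin this] obtain P where
    P: "partition_on V P" "\<And>K. K \<in> P \<Longrightarrow> edge_cut (E - rep ` E) K = {}"
      "card V \<le> card P + card (E - rep ` E)"
    by auto
  have "card (E - rep ` E) = card E - card (rep ` E)"
    using finite_E rep_in_E by (intro card_Diff_subset) auto
  then have card: "card V \<le> card P + (card E - card (rep ` E))" using P(3) by simp
  have "edge_cut E (\<Union>X) \<subseteq> rep ` E" if "X \<subseteq> P" for X
  proof
    fix e assume e: "e \<in> edge_cut E (\<Union>X)"
    then obtain u K where "u \<in> e" "u \<in> K" "K \<in> X" by (auto simp: edge_cut_def)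
    then have "e \<in> edge_cut E K" using e by (auto simp: edge_cut_def)
    moreover have "edge_cut E K - rep ` E = {}"
      using P(2)[of K] \<open>K \<in> X\<close> that by (auto simp: edge_cut_Diff)
    ultimately show "e \<in> rep ` E" by auto
  qed
  from that[OF P(1) card this] show ?thesis by blast
qed

text \<open>\<open>K\<close> and \<open>L\<close> are the ends of \<open>e\<close> after
  contraction. If \<open>K = L\<close>, the edge has become a loop and lies in no cut of a union of
  blocks.\<close>

lemma block_incidence:
  assumes "partition_on V P" "e \<in> E"
  obtains K L where "K \<in> P" "L \<in> P" "\<And>X. X \<subseteq> P \<Longrightarrow> e \<in> edge_cut E (\<Union>X) \<longleftrightarrow> (K \<in> X \<longleftrightarrow> L \<notin> X)"
    "{M \<in> P. e \<in> edge_cut E M} = (if K = L then {} else {K, L})"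
proof -
  obtain u v where e: "e = {u, v}" "u \<in> V" "v \<in> V" using edge_cases[OF assms(2)] by metis
  obtain K L where KL: "K \<in> P" "L \<in> P" "u \<in> K" "v \<in> L" using e assms(1) by (auto simp: partition_on_def)
  have mem: "u \<in> M \<longleftrightarrow> M = K" "v \<in> M \<longleftrightarrow> M = L" if "M \<in> P" for M
    using that KL assms(1) by (auto simp: partition_on_def disjoint_def)
  then have memU: "u \<in> \<Union>X \<longleftrightarrow> K \<in> X" "v \<in> \<Union>X \<longleftrightarrow> L \<in> X" if "X \<subseteq> P" for X
    using that by blast+
  have blocks: "{M \<in> P. e \<in> edge_cut E M} = (if K = L then {} else {K, L})"
    using mem KL assms(2) unfolding e(1) doubleton_in_edge_cut_iff by auto
  have "e \<in> edge_cut E (\<Union>X) \<longleftrightarrow> (K \<in> X \<longleftrightarrow> L \<notin> X)" if "X \<subseteq> P" for X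
    using memU[OF that] assms(2) unfolding e(1) doubleton_in_edge_cut_iff by auto
  from that[OF KL(1,2) this blocks] show ?thesis by blast
qed

lemma proper_part_Union:
  assumes "partition_on V P" "proper_part P X"
  shows "proper_part V (\<Union>X)"
proof -
  obtain K L where "X \<subseteq> P" "K \<in> X" "L \<in> P" "L \<notin> X" using assms(2) by (auto simp: proper_part_def)
  moreover have "K \<noteq> {}" "L \<noteq> {}" "\<Union>X \<subseteq> V"
    using calculation assms(1) by (auto simp: partition_on_def)
  moreover have "L \<inter> M = {}" if "M \<in> X" for M
    using calculation that assms(1) by (metis partition_onD2 disjointD subsetD)
  moreover have "L \<subseteq> V" using calculation assms(1) by (auto simp: partition_on_def)
  ultimately show ?thesis unfolding proper_part_def by blast
qed

text \<open>Double counting of incidences: the left side is the degree sum of the contracted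
  multigraph.\<close>

lemma sum_block_cuts:
  assumes "partition_on V P" "\<And>X. X \<subseteq> P \<Longrightarrow> edge_cut E (\<Union>X) \<subseteq> rep ` E"
  shows "(\<Sum>K\<in>P. card (edge_cut E K)) = (\<Sum>r\<in>rep ` E. card {K \<in> P. r \<in> edge_cut E K})"
proof -
  have finP: "finite P" using assms(1) finite_V finite_elements by blast
  have "edge_cut E K = {r \<in> rep ` E. r \<in> edge_cut E K}" if "K \<in> P" for K
    using assms(2)[of "{K}"] that by auto
  then have "(\<Sum>K\<in>P. card (edge_cut E K)) = (\<Sum>K\<in>P. card {r \<in> rep ` E. r \<in> edge_cut E K})"
    by (intro sum.cong) auto
  also have "\<dots> = (\<Sum>K\<in>P. \<Sum>r\<in>{r \<in> rep ` E. r \<in> edge_cut E K}. 1)" by simp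
  also have "\<dots> = (\<Sum>r\<in>rep ` E. \<Sum>K\<in>{K \<in> P. r \<in> edge_cut E K}. 1)"
    using finP finite_E by (intro sum.swap_restrict) auto
  finally show ?thesis by simp
qed

lemma card_incident_blocks:
  assumes "partition_on V P" "r \<in> rep ` E"
  shows "card {K \<in> P. r \<in> edge_cut E K} \<le> 2"
proof -
  have "r \<in> E" using assms(2) rep_in_E by auto
  then obtain K L where "{K \<in> P. r \<in> edge_cut E K} = (if K = L then {} else {K, L})"
    by (rule block_incidence[OF assms(1)]) blast
  then show ?thesis by (simp add: card_insert_if)
qed

lemma card_block_cut:
  assumes "partition_on V P" "\<And>X. X \<subseteq> P \<Longrightarrow> edge_cut E (\<Union>X) \<subseteq> rep ` E"
    and "2 \<le> card P" "K \<in> P"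
  shows "3 \<le> card (edge_cut E K)"
proof -
  have "proper_part P {K}" using assms(3,4) by (auto simp: proper_part_def)
  then have "proper_part V K" using proper_part_Union[OF assms(1)] by fastforce
  moreover have "edge_cut E K \<subseteq> rep ` E" using assms(2)[of "{K}"] assms(4) by simp
  ultimately show ?thesis by (rule card_edge_cut_of_reps)
qed

text \<open>With at least two blocks all degrees are at least 3, so \<open>3 * card P\<close> is at
  most twice the number of representatives, and this number is at most \<open>card P + 4\<close>.
  With fewer blocks there are at most five representatives.\<close>

lemma card_reps_le:
  assumes "card E = card V + 4"
  shows "card (rep ` E) \<le> 12"
proof -
  obtain P where P: "partition_on V P" "card V \<le> card P + (card E - card (rep ` E))"
    "\<And>X. X \<subseteq> P \<Longrightarrow> edge_cut E (\<Union>X) \<subseteq> rep ` E"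
    by (rule partition_by_nonreps) blast
  show ?thesis
  proof (cases "2 \<le> card P")
    case True
    have "3 * card P = (\<Sum>K\<in>P. 3)" by simp
    also have "\<dots> \<le> (\<Sum>K\<in>P. card (edge_cut E K))"
      using card_block_cut[OF P(1,3) True] by (intro sum_mono) blast
    also have "\<dots> = (\<Sum>r\<in>rep ` E. card {K \<in> P. r \<in> edge_cut E K})" by (rule sum_block_cuts[OF P(1,3)])
    also have "\<dots> \<le> (\<Sum>r\<in>rep ` E. 2)"
      using card_incident_blocks[OF P(1)] by (intro sum_mono) blast
    finally have "3 * card P \<le> 2 * card (rep ` E)" by simp
    then show ?thesis using P(2) assms card_image_le[OF finite_E, of rep] by linarith
  qed (use P(2) assms card_image_le[OF finite_E, of rep] in linarith)
qed

text \<open>Twelve representatives force equality throughout the degree count, so the contracted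
  multigraph has eight vertices, all degrees 3 and no loops. Its vertices are blocks, which explains
  the change of vertex type.\<close>

lemma cubic_base:
  assumes E: "card E = card V + 4" and reps: "card (rep ` E) = 12"
  obtains P :: "'a set set" and F where "three_connected_cubic P F" "card P = 8"
    "card {B \<in> removals (V, E) k. B \<subseteq> rep ` E} \<le> card (removals (P, F) k)"
proof -
  let ?R = "rep ` E"
  obtain P where P: "partition_on V P" "card V \<le> card P + (card E - card ?R)"
    "\<And>X. X \<subseteq> P \<Longrightarrow> edge_cut E (\<Union>X) \<subseteq> ?R"
    by (rule partition_by_nonreps) blast
  have finP: "finite P" using P(1) finite_V finite_elements by blast
  have P8: "8 \<le> card P" using P(2) E reps card_image_le[OF finite_E, of rep] by linarith
  have RE: "?R \<subseteq> E" using rep_in_E by auto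
  have ge3: "3 \<le> card (edge_cut E K)" if "K \<in> P" for K
    using card_block_cut[OF P(1,3) _ that] P8 by auto
  have le2: "card {K \<in> P. r \<in> edge_cut E K} \<le> 2" if "r \<in> ?R" for r
    using card_incident_blocks[OF P(1) that] .
  have sum_eq: "(\<Sum>K\<in>P. card (edge_cut E K)) = (\<Sum>r\<in>?R. card {K \<in> P. r \<in> edge_cut E K})"
    by (rule sum_block_cuts[OF P(1,3)])
  have lower: "3 * card P \<le> (\<Sum>K\<in>P. card (edge_cut E K))"
    using sum_mono[of P "\<lambda>_. 3" "\<lambda>K. card (edge_cut E K)"] ge3 by simp
  have upper: "(\<Sum>r\<in>?R. card {K \<in> P. r \<in> edge_cut E K}) \<le> 24"
    using sum_mono[of ?R "\<lambda>r. card {K \<in> P. r \<in> edge_cut E K}" "\<lambda>_. 2"] le2 reps by simp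
  have cardP: "card P = 8" using lower upper sum_eq P8 by linarith
  have deg: "card (edge_cut E K) = 3" if "K \<in> P" for K
  proof (rule ccontr)
    assume "card (edge_cut E K) \<noteq> 3"
    then have "(\<Sum>K\<in>P. 3) < (\<Sum>K\<in>P. card (edge_cut E K))"
      using ge3 that finP by (intro sum_strict_mono_ex1) (auto simp: le_less)
    then show False using upper sum_eq cardP by simp
  qed
  \<comment> \<open>The edge of the contracted graph that comes from \<open>r\<close>, as the pair
    of blocks which \<open>r\<close> joins.\<close>
  define \<phi> where "\<phi> r = {K \<in> P. r \<in> edge_cut E K}" for r
  have card_\<phi>: "card (\<phi> r) = 2" if "r \<in> ?R" for r
  proof (rule ccontr)
    assume "card (\<phi> r) \<noteq> 2"
    then have "(\<Sum>r\<in>?R. card {K \<in> P. r \<in> edge_cut E K}) < (\<Sum>r\<in>?R. 2)"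
      using le2 that finite_E by (intro sum_strict_mono_ex1) (auto simp: le_less \<phi>_def)
    then show False using lower sum_eq cardP reps by simp
  qed
  have cut_Union: "r \<in> edge_cut E (\<Union>X) \<longleftrightarrow> \<phi> r \<in> edge_cut (\<phi> ` ?R) X"
    if "r \<in> ?R" "X \<subseteq> P" for r X
  proof -
    have "r \<in> E" using that RE by auto
    then obtain K L where KL: "K \<in> P" "L \<in> P"
      "\<And>X. X \<subseteq> P \<Longrightarrow> r \<in> edge_cut E (\<Union>X) \<longleftrightarrow> (K \<in> X \<longleftrightarrow> L \<notin> X)"
      "{M \<in> P. r \<in> edge_cut E M} = (if K = L then {} else {K, L})"
      by (rule block_incidence[OF P(1)]) blast
    have "card (if K = L then {} else {K, L}) = 2"
      using card_\<phi>[OF that(1)] KL(4) by (simp only: \<phi>_def)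
    then have "K \<noteq> L" by auto
    then have \<phi>_r: "\<phi> r = {K, L}" using KL(4) by (simp only: \<phi>_def if_False)
    have "\<phi> r \<in> \<phi> ` ?R" using that(1) by (rule imageI)
    then show ?thesis using KL(3)[OF that(2)] unfolding \<phi>_r doubleton_in_edge_cut_iff by simp
  qed
  \<comment> \<open>There are no parallel edges: if \<open>r\<close> and \<open>s\<close> both
    joined \<open>K\<close> to \<open>L\<close>, only one further edge would remain at each of the
    two blocks. Their union would then have a cut of at most two edges.\<close>
  have inj: "inj_on \<phi> ?R"
  proof (rule inj_onI, rule ccontr)
    fix r s assume rs: "r \<in> ?R" "s \<in> ?R" "\<phi> r = \<phi> s" "r \<noteq> s"
    obtain K L where KL: "\<phi> r = {K, L}" "K \<noteq> L" using card_\<phi>[OF rs(1)] by (auto simp: card_2_iff)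
    then have mem: "K \<in> P" "L \<in> P" "r \<in> edge_cut E K" "r \<in> edge_cut E L" "s \<in> edge_cut E K" "s \<in> edge_cut E L"
      using rs(3) unfolding \<phi>_def by blast+
    have "K \<inter> L = {}" using KL mem P(1) by (auto simp: partition_on_def disjoint_def)
    then have KL_eq: "(K - L) \<union> (L - K) = \<Union>{K, L}" by auto
    have cut_eq: "edge_cut E (\<Union>{K, L}) = (edge_cut E K - edge_cut E L) \<union> (edge_cut E L - edge_cut E K)"
      using edge_cut_sym_diff[OF simple, of K L] unfolding KL_eq .
    have fin: "finite (edge_cut E M)" for M using finite_subset[OF edge_cut_subset finite_E] .
    have "card (edge_cut E (\<Union>{K, L})) \<le> card ((edge_cut E K - {r, s}) \<union> (edge_cut E L - {r, s}))"
      unfolding cut_eq using mem fin by (intro card_mono) auto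
    also have "\<dots> \<le> card (edge_cut E K - {r, s}) + card (edge_cut E L - {r, s})" by (rule card_Un_le)
    also have "\<dots> = 2" using mem rs(4) deg by (simp add: card_Diff_subset)
    finally have "card (edge_cut E (\<Union>{K, L})) \<le> 2" .
    moreover have "{K, L} \<noteq> P"
    proof
      assume "{K, L} = P"
      then have "card P \<le> 2" using card_insert_le_m1[of 2 "{L}" K] by auto
      then show False using cardP by simp
    qed
    then have "proper_part P {K, L}" using mem by (auto simp: proper_part_def)
    then have "3 \<le> card (edge_cut E (\<Union>{K, L}))"
      using card_edge_cut_of_reps proper_part_Union[OF P(1)] P(3)[of "{K, L}"] mem by blast
    ultimately show False by simp
  qed
  have img_cut: "edge_cut (\<phi> ` ?R) X = \<phi> ` edge_cut E (\<Union>X)" if "X \<subseteq> P" for X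
  proof (intro set_eqI iffI)
    fix e assume e: "e \<in> edge_cut (\<phi> ` ?R) X"
    then obtain r where "r \<in> ?R" "e = \<phi> r" using edge_cut_subset by blast
    then show "e \<in> \<phi> ` edge_cut E (\<Union>X)" using cut_Union that e by blast
  next
    fix e assume "e \<in> \<phi> ` edge_cut E (\<Union>X)"
    then show "e \<in> edge_cut (\<phi> ` ?R) X" using cut_Union[OF _ that] P(3)[OF that] by blast
  qed
  have card_cut: "card (edge_cut (\<phi> ` ?R) X) = card (edge_cut E (\<Union>X))" if "X \<subseteq> P" for X
    unfolding img_cut[OF that] by (rule card_image[OF inj_on_subset[OF inj P(3)[OF that]]])
  have simple': "simple_ugraph (P, \<phi> ` ?R)"
    using finP card_\<phi> by (auto simp: simple_ugraph_def \<phi>_def)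
  have "three_connected_cubic P (\<phi> ` ?R)"
    unfolding three_connected_cubic_def
  proof (intro conjI ballI allI impI simple')
    fix K assume K: "K \<in> P"
    have "{e \<in> \<phi> ` ?R. K \<in> e} = \<phi> ` edge_cut E K"
      using K P(3)[of "{K}"] by (auto simp: \<phi>_def)
    moreover have "inj_on \<phi> (edge_cut E K)" using inj_on_subset[OF inj] P(3)[of "{K}"] K by simp
    ultimately show "card {e \<in> \<phi> ` ?R. K \<in> e} = 3" using deg[OF K] by (simp add: card_image)
  next
    fix X assume X: "proper_part P X"
    then have "X \<subseteq> P" by (simp add: proper_part_def)
    then show "3 \<le> card (edge_cut (\<phi> ` ?R) X)"
      using card_cut card_edge_cut_of_reps[OF proper_part_Union[OF P(1) X]] P(3) by simp
  qed
  moreover have "card {B \<in> removals (V, E) k. B \<subseteq> ?R} \<le> card (removals (P, \<phi> ` ?R) k)"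
  proof (rule card_inj_on_le[of "image \<phi>"])
    show "inj_on (image \<phi>) {B \<in> removals (V, E) k. B \<subseteq> ?R}"
      using inj by (auto intro!: inj_onI simp: inj_on_image_eq_iff)
    show "finite (removals (P, \<phi> ` ?R) k)"
      using finite_E by (intro finite_removals) simp
    show "image \<phi> ` {B \<in> removals (V, E) k. B \<subseteq> ?R} \<subseteq> removals (P, \<phi> ` ?R) k"
    proof safe
      fix B assume B: "B \<in> removals (V, E) k" "B \<subseteq> ?R"
      have noncut: "\<not> edge_cut E S \<subseteq> B" if "proper_part V S" for S
        using B(1) that simple nonempty by (auto simp: removals_def connected_Diff_iff_cut)
      have "\<not> edge_cut (\<phi> ` ?R) X \<subseteq> \<phi> ` B" if X: "proper_part P X" for X
      proof
        assume sub: "edge_cut (\<phi> ` ?R) X \<subseteq> \<phi> ` B"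
        have XP: "X \<subseteq> P" using X by (simp add: proper_part_def)
        have "edge_cut E (\<Union>X) \<subseteq> B"
          using sub unfolding img_cut[OF XP] inj_on_image_subset_iff[OF inj P(3)[OF XP] B(2)] .
        then show False using noncut proper_part_Union[OF P(1) X] by blast
      qed
      then have "ugraph_connected (P, \<phi> ` ?R - \<phi> ` B)"
        using simple' cardP by (subst connected_Diff_iff_cut) auto
      moreover have "card (\<phi> ` B) = k"
        using B inj_on_subset[OF inj B(2)] by (simp add: removals_def card_image)
      ultimately show "\<phi> ` B \<in> removals (P, \<phi> ` ?R) k" using B(2) by (auto simp: removals_def)
    qed
  qed
  ultimately show ?thesis using that cardP by blast
qed

end

section \<open>Counting connected edge removals in a concrete graph\<close>

definition cut_indices :: "(nat \<times> nat) list \<Rightarrow> nat set \<Rightarrow> nat set" where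
  "cut_indices es X = {k. k < length es \<and> (fst (es ! k) \<in> X \<longleftrightarrow> snd (es ! k) \<notin> X)}"

text \<open>Edges enter by their positions in the list, so that a list of weights can run
  alongside.\<close>

definition removable :: "nat \<Rightarrow> (nat \<times> nat) list \<Rightarrow> nat \<Rightarrow> nat set set" where
  "removable n es k = {I. I \<subseteq> {..<length es} \<and> card I = k \<and>
     (\<forall>X. proper_part {..<n} X \<longrightarrow> \<not> cut_indices es X \<subseteq> I)}"

lemma finite_removable: "finite (removable n es k)"
  unfolding removable_def by (rule finite_subset[of _ "Pow {..<length es}"]) auto

text \<open>Branches on whether the next edge is retained or removed. \<open>cs\<close> holds the
  cuts that contain no retained edge so far, as vectors over the undecided edges. Retaining an edge
  discharges the cuts through it, removing it contributes the factor \<open>w\<close>, and at the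
  end no cut may be left.\<close>

fun weighted_count :: "bool list list \<Rightarrow> int list \<Rightarrow> nat \<Rightarrow> int" where
  "weighted_count cs [] k = (if k = 0 \<and> cs = [] then 1 else 0)"
| "weighted_count cs (w # ws) 0 = weighted_count (map tl (filter (\<lambda>c. \<not> hd c) cs)) ws 0"
| "weighted_count cs (w # ws) (Suc k) = weighted_count (map tl (filter (\<lambda>c. \<not> hd c) cs)) ws (Suc k)
     + w * weighted_count (map tl cs) ws k"

text \<open>Complementary vertex sets have the same cut, so only those containing vertex 0 are listed.\<close>

definition cut_vectors :: "nat \<Rightarrow> (nat \<times> nat) list \<Rightarrow> bool list list" where
  "cut_vectors n es = map (\<lambda>x. map (\<lambda>(i, j). x ! i \<noteq> x ! j) es)
     (filter (\<lambda>x. \<not> list_all id x) (map (\<lambda>x. True # x) (List.n_lists (n - 1) [True, False])))"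

definition avoiding :: "bool list list \<Rightarrow> nat \<Rightarrow> nat \<Rightarrow> nat set set" where
  "avoiding cs n k = {I. I \<subseteq> {..<n} \<and> card I = k \<and> (\<forall>c\<in>set cs. \<not> {i. i < n \<and> c ! i} \<subseteq> I)}"

lemma finite_avoiding: "finite (avoiding cs n k)"
  unfolding avoiding_def by (rule finite_subset[of _ "Pow {..<n}"]) auto

lemma subset_lessThan_Suc_cases:
  assumes "I \<subseteq> {..<Suc n}"
  obtains J where "J \<subseteq> {..<n}" "I = Suc ` J \<or> I = insert 0 (Suc ` J)"
proof -
  define J where "J = {i. Suc i \<in> I}"
  have "J \<subseteq> {..<n}" using assms by (auto simp: J_def)
  moreover have "I = Suc ` J \<or> I = insert 0 (Suc ` J)"
  proof (cases "0 \<in> I")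
    case True
    then have "I = insert 0 (Suc ` J)" by (auto simp: J_def image_iff) (metis not0_implies_Suc)
    then show ?thesis by simp
  next
    case False
    then have "I = Suc ` J" by (auto simp: J_def image_iff) (metis not0_implies_Suc)
    then show ?thesis by simp
  qed
  ultimately show ?thesis using that by blast
qed

lemma vector_subset_Suc:
  "{i. i < Suc n \<and> (b # c) ! i} \<subseteq> Suc ` J \<longleftrightarrow> \<not> b \<and> {i. i < n \<and> c ! i} \<subseteq> J"
  "{i. i < Suc n \<and> (b # c) ! i} \<subseteq> insert 0 (Suc ` J) \<longleftrightarrow> {i. i < n \<and> c ! i} \<subseteq> J"
proof -
  have *: "{i. i < Suc n \<and> (b # c) ! i} = (if b then {0} else {}) \<union> Suc ` {i. i < n \<and> c ! i}"
  proof (rule set_eqI)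
    show "i \<in> {i. i < Suc n \<and> (b # c) ! i} \<longleftrightarrow> i \<in> (if b then {0} else {}) \<union> Suc ` {i. i < n \<and> c ! i}" for i
      by (cases i) auto
  qed
  show "{i. i < Suc n \<and> (b # c) ! i} \<subseteq> Suc ` J \<longleftrightarrow> \<not> b \<and> {i. i < n \<and> c ! i} \<subseteq> J"
    "{i. i < Suc n \<and> (b # c) ! i} \<subseteq> insert 0 (Suc ` J) \<longleftrightarrow> {i. i < n \<and> c ! i} \<subseteq> J"
    unfolding * by auto
qed

text \<open>The two parts are the sets without and with position 0; the shift by \<open>Suc\<close>
  corresponds to passing to the tails of the vectors.\<close>

lemma avoiding_Suc:
  assumes "\<And>c. c \<in> set cs \<Longrightarrow> length c = Suc n"
  shows "avoiding cs (Suc n) k = image Suc ` avoiding (map tl (filter (\<lambda>c. \<not> hd c) cs)) n k \<union>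
    (case k of 0 \<Rightarrow> {} | Suc l \<Rightarrow> (\<lambda>J. insert 0 (Suc ` J)) ` avoiding (map tl cs) n l)"
    (is "?A = ?B \<union> ?C")
proof -
  have sub1: "{i. i < Suc n \<and> c ! i} \<subseteq> Suc ` J \<longleftrightarrow> \<not> hd c \<and> {i. i < n \<and> tl c ! i} \<subseteq> J"
    and sub2: "{i. i < Suc n \<and> c ! i} \<subseteq> insert 0 (Suc ` J) \<longleftrightarrow> {i. i < n \<and> tl c ! i} \<subseteq> J"
    if c: "c \<in> set cs" for c J
  proof -
    obtain b d where "c = b # d" using assms[OF c] by (cases c) auto
    then show "{i. i < Suc n \<and> c ! i} \<subseteq> Suc ` J \<longleftrightarrow> \<not> hd c \<and> {i. i < n \<and> tl c ! i} \<subseteq> J"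
      "{i. i < Suc n \<and> c ! i} \<subseteq> insert 0 (Suc ` J) \<longleftrightarrow> {i. i < n \<and> tl c ! i} \<subseteq> J"
      using vector_subset_Suc by simp_all
  qed
  have mem1: "Suc ` J \<in> ?A \<longleftrightarrow> J \<in> avoiding (map tl (filter (\<lambda>c. \<not> hd c) cs)) n k"
    if "J \<subseteq> {..<n}" for J
  proof -
    have "(\<forall>c\<in>set cs. \<not> {i. i < Suc n \<and> c ! i} \<subseteq> Suc ` J) \<longleftrightarrow>
      (\<forall>c\<in>set cs. \<not> (\<not> hd c \<and> {i. i < n \<and> tl c ! i} \<subseteq> J))"
      by (intro ball_cong refl) (simp only: sub1)
    then show ?thesis using that by (auto simp: avoiding_def card_image)
  qed
  have mem2: "insert 0 (Suc ` J) \<in> ?A \<longleftrightarrow> (\<exists>l. k = Suc l \<and> J \<in> avoiding (map tl cs) n l)"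
    if "J \<subseteq> {..<n}" for J
  proof -
    have "card (insert 0 (Suc ` J)) = Suc (card J)"
      using finite_subset[OF that] by (simp add: card_image card_insert_if image_iff)
    moreover have "(\<forall>c\<in>set cs. \<not> {i. i < Suc n \<and> c ! i} \<subseteq> insert 0 (Suc ` J)) \<longleftrightarrow>
      (\<forall>c\<in>set cs. \<not> {i. i < n \<and> tl c ! i} \<subseteq> J)"
      by (intro ball_cong refl) (simp only: sub2)
    ultimately show ?thesis using that by (auto simp: avoiding_def)
  qed
  show ?thesis
  proof (intro set_eqI iffI)
    fix I assume I: "I \<in> ?A"
    then have "I \<subseteq> {..<Suc n}" by (simp add: avoiding_def)
    then obtain J where "J \<subseteq> {..<n}" "I = Suc ` J \<or> I = insert 0 (Suc ` J)"
      by (rule subset_lessThan_Suc_cases)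
    then show "I \<in> ?B \<union> ?C" using I mem1[of J] mem2[of J] by auto
  next
    fix I assume "I \<in> ?B \<union> ?C"
    then show "I \<in> ?A"
    proof
      assume "I \<in> ?B"
      then obtain J where "I = Suc ` J" "J \<in> avoiding (map tl (filter (\<lambda>c. \<not> hd c) cs)) n k" by auto
      then show ?thesis using mem1[of J] by (auto simp: avoiding_def)
    next
      assume "I \<in> ?C"
      then obtain J l where "k = Suc l" "I = insert 0 (Suc ` J)" "J \<in> avoiding (map tl cs) n l"
        by (auto split: nat.splits)
      moreover have "J \<subseteq> {..<n}" using calculation by (simp add: avoiding_def)
      ultimately show ?thesis using mem2[of J] by blast
    qed
  qed
qed

lemma weighted_count_eq_sum:
  assumes "\<And>c. c \<in> set cs \<Longrightarrow> length c = length ws"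
  shows "weighted_count cs ws k = (\<Sum>I\<in>avoiding cs (length ws) k. \<Prod>i\<in>I. ws ! i)"
  using assms
proof (induction cs ws k rule: weighted_count.induct)
  case (1 cs k)
  have "avoiding cs 0 k = (if k = 0 \<and> cs = [] then {{}} else {})"
    by (cases cs) (auto simp: avoiding_def)
  then show ?case by simp
next
  case (2 cs w ws)
  have "(\<Sum>I\<in>avoiding cs (length (w # ws)) 0. \<Prod>i\<in>I. (w # ws) ! i) =
    (\<Sum>I\<in>image Suc ` avoiding (map tl (filter (\<lambda>c. \<not> hd c) cs)) (length ws) 0. \<Prod>i\<in>I. (w # ws) ! i)"
    using avoiding_Suc[of cs "length ws" 0] 2(2) by simp
  also have "\<dots> = (\<Sum>J\<in>avoiding (map tl (filter (\<lambda>c. \<not> hd c) cs)) (length ws) 0. \<Prod>i\<in>J. ws ! i)"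
    by (rule sum.reindex_cong[of "image Suc"]) (auto simp: prod.reindex inj_image_eq_iff intro!: inj_onI)
  also have "\<dots> = weighted_count (map tl (filter (\<lambda>c. \<not> hd c) cs)) ws 0"
    using 2(2) by (intro 2(1)[symmetric]) fastforce
  finally show ?case by simp
next
  case (3 cs w ws k)
  let ?A = "avoiding (map tl (filter (\<lambda>c. \<not> hd c) cs)) (length ws) (Suc k)"
  let ?B = "avoiding (map tl cs) (length ws) k"
  have fin: "finite J" if "J \<in> ?B" for J
    using that by (auto simp: avoiding_def intro: finite_subset)
  have "(\<Sum>I\<in>avoiding cs (length (w # ws)) (Suc k). \<Prod>i\<in>I. (w # ws) ! i) =
    (\<Sum>I\<in>image Suc ` ?A \<union> (\<lambda>J. insert 0 (Suc ` J)) ` ?B. \<Prod>i\<in>I. (w # ws) ! i)"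
    using avoiding_Suc[of cs "length ws" "Suc k"] 3(3) by simp
  also have "\<dots> = (\<Sum>I\<in>image Suc ` ?A. \<Prod>i\<in>I. (w # ws) ! i) +
      (\<Sum>I\<in>(\<lambda>J. insert 0 (Suc ` J)) ` ?B. \<Prod>i\<in>I. (w # ws) ! i)"
    using finite_avoiding by (intro sum.union_disjoint) auto
  also have "(\<Sum>I\<in>image Suc ` ?A. \<Prod>i\<in>I. (w # ws) ! i) = (\<Sum>J\<in>?A. \<Prod>i\<in>J. ws ! i)"
    by (rule sum.reindex_cong[of "image Suc"]) (auto simp: prod.reindex inj_image_eq_iff intro!: inj_onI)
  also have "(\<Sum>I\<in>(\<lambda>J. insert 0 (Suc ` J)) ` ?B. \<Prod>i\<in>I. (w # ws) ! i) = (\<Sum>J\<in>?B. w * (\<Prod>i\<in>J. ws ! i))"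
  proof (rule sum.reindex_cong[of "\<lambda>J. insert 0 (Suc ` J)"])
    show "inj_on (\<lambda>J. insert 0 (Suc ` J)) ?B"
    proof (rule inj_onI)
      fix J K :: "nat set" assume "insert 0 (Suc ` J) = insert 0 (Suc ` K)"
      then have "Suc ` J = Suc ` K" by auto
      then show "J = K" by (simp add: inj_image_eq_iff)
    qed
    show "(\<Prod>i\<in>insert 0 (Suc ` J). (w # ws) ! i) = w * (\<Prod>i\<in>J. ws ! i)" if "J \<in> ?B" for J
      using fin[OF that] by (subst prod.insert) (auto simp: prod.reindex)
  qed simp
  also have "\<dots> = w * (\<Sum>J\<in>?B. \<Prod>i\<in>J. ws ! i)" by (simp add: sum_distrib_left)
  also have "(\<Sum>J\<in>?B. \<Prod>i\<in>J. ws ! i) = weighted_count (map tl cs) ws k"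
    using 3(3) by (intro 3(2)[symmetric]) fastforce
  also have "(\<Sum>J\<in>?A. \<Prod>i\<in>J. ws ! i) = weighted_count (map tl (filter (\<lambda>c. \<not> hd c) cs)) ws (Suc k)"
    using 3(3) by (intro 3(1)[symmetric]) fastforce
  finally show ?case by simp
qed

lemma cut_vector_indices:
  assumes "length x = n" "\<forall>(i, j)\<in>set es. i < n \<and> j < n"
  shows "{k. k < length es \<and> map (\<lambda>(i, j). x ! i \<noteq> x ! j) es ! k} = cut_indices es {i. i < n \<and> x ! i}"
proof -
  have "fst (es ! k) < n" "snd (es ! k) < n" if "k < length es" for k
    using assms(2) nth_mem[OF that] by (auto simp: case_prod_beta)
  then show ?thesis by (auto simp: cut_indices_def case_prod_beta)
qed

lemma avoiding_cut_vectors: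
  assumes "0 < n" and es: "\<forall>(i, j)\<in>set es. i < n \<and> j < n"
  shows "avoiding (cut_vectors n es) (length es) k = removable n es k"
proof -
  have "(\<forall>c\<in>set (cut_vectors n es). \<not> {i. i < length es \<and> c ! i} \<subseteq> I) \<longleftrightarrow>
    (\<forall>X. proper_part {..<n} X \<longrightarrow> \<not> cut_indices es X \<subseteq> I)" for I
  proof
    assume L: "\<forall>c\<in>set (cut_vectors n es). \<not> {i. i < length es \<and> c ! i} \<subseteq> I"
    have *: "\<not> cut_indices es X \<subseteq> I" if X: "proper_part {..<n} X" "0 \<in> X" for X
    proof -
      define x where "x = map (\<lambda>i. i \<in> X) [0..<n]"
      have len: "length x = n" by (simp add: x_def)
      have Xeq: "{i. i < n \<and> x ! i} = X" using X by (auto simp: x_def proper_part_def)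
      obtain j where "j < n" "j \<notin> X" using X by (auto simp: proper_part_def)
      then have "\<not> list_all id x" using len by (auto simp: list_all_length x_def intro!: exI[of _ j])
      moreover have "x = True # map (\<lambda>i. i \<in> X) [1..<n]"
        using \<open>0 < n\<close> X(2) by (simp add: x_def upt_conv_Cons)
      ultimately have "map (\<lambda>(i, j). x ! i \<noteq> x ! j) es \<in> set (cut_vectors n es)"
        unfolding cut_vectors_def set_map by (intro imageI) (auto simp: set_n_lists image_iff)
      then show ?thesis using L cut_vector_indices[OF len es] Xeq by auto
    qed
    show "\<forall>X. proper_part {..<n} X \<longrightarrow> \<not> cut_indices es X \<subseteq> I"
    proof (intro allI impI)
      fix X assume X: "proper_part {..<n} X"
      show "\<not> cut_indices es X \<subseteq> I"
      proof (cases "0 \<in> X")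
        case False
        have "proper_part {..<n} ({..<n} - X)" "0 \<in> {..<n} - X"
          using X False \<open>0 < n\<close> by (auto simp: proper_part_def)
        moreover have "cut_indices es ({..<n} - X) = cut_indices es X"
        proof -
          have "fst (es ! k) < n" "snd (es ! k) < n" if "k < length es" for k
            using es nth_mem[OF that] by (auto simp: case_prod_beta)
          then show ?thesis by (auto simp: cut_indices_def)
        qed
        ultimately show ?thesis using * by metis
      qed (use * X in auto)
    qed
  next
    assume R: "\<forall>X. proper_part {..<n} X \<longrightarrow> \<not> cut_indices es X \<subseteq> I"
    show "\<forall>c\<in>set (cut_vectors n es). \<not> {i. i < length es \<and> c ! i} \<subseteq> I"
    proof
      fix c assume "c \<in> set (cut_vectors n es)"
      then obtain x where c: "c = map (\<lambda>(i, j). x ! i \<noteq> x ! j) es" and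
        "x \<in> set (filter (\<lambda>x. \<not> list_all id x) (map (\<lambda>x. True # x) (List.n_lists (n - 1) [True, False])))"
        unfolding cut_vectors_def set_map[of _ "filter _ _"] by (rule imageE)
      then have x: "\<not> list_all id x" "length x = n" "x ! 0"
        using \<open>0 < n\<close> by (auto simp: set_n_lists)
      have "proper_part {..<n} {i. i < n \<and> x ! i}"
        using x \<open>0 < n\<close> unfolding proper_part_def list_all_length by auto
      then show "\<not> {i. i < length es \<and> c ! i} \<subseteq> I"
        using R cut_vector_indices[OF x(2) es] c by auto
    qed
  qed
  then show ?thesis by (simp add: avoiding_def removable_def)
qed

lemma sum_removable:
  assumes "0 < n" "\<forall>(i, j)\<in>set es. i < n \<and> j < n" "length ws = length es"
  shows "(\<Sum>I\<in>removable n es k. \<Prod>i\<in>I. ws ! i) = weighted_count (cut_vectors n es) ws k"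
proof -
  have "length c = length ws" if "c \<in> set (cut_vectors n es)" for c
    using that assms(3) by (auto simp: cut_vectors_def)
  then show ?thesis
    using weighted_count_eq_sum[of "cut_vectors n es" ws k] avoiding_cut_vectors[OF assms(1,2)] assms(3) by simp
qed

lemma card_removable:
  assumes "0 < n" "\<forall>(i, j)\<in>set es. i < n \<and> j < n"
  shows "int (card (removable n es k)) = weighted_count (cut_vectors n es) (replicate (length es) 1) k"
proof -
  have "(\<Sum>I\<in>removable n es k. \<Prod>i\<in>I. replicate (length es) (1::int) ! i) = (\<Sum>I\<in>removable n es k. 1)"
  proof (intro sum.cong refl prod.neutral ballI)
    fix I i assume "I \<in> removable n es k" "i \<in> I"
    then show "replicate (length es) (1::int) ! i = 1" by (auto simp: removable_def)
  qed
  then show ?thesis using sum_removable[OF assms, of "replicate (length es) 1" k] by simp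
qed

lemma card_removals_list_graph_le:
  assumes v: "inj_on v {..<n}" and es: "\<forall>(i, j)\<in>set es. i < n \<and> j < n"
    and dist: "distinct (map (\<lambda>(i, j). {i, j}) es)"
    and simple: "simple_ugraph (v ` {..<n}, (\<lambda>(i, j). {v i, v j}) ` set es)" and "0 < n"
  shows "card (removals (v ` {..<n}, (\<lambda>(i, j). {v i, v j}) ` set es) k) \<le> card (removable n es k)"
proof -
  let ?V = "v ` {..<n}" and ?E = "(\<lambda>(i, j). {v i, v j}) ` set es"
  let ?e = "\<lambda>k. {v (fst (es ! k)), v (snd (es ! k))}"
  have bound: "fst (es ! k) < n" "snd (es ! k) < n" if "k < length es" for k
    using es nth_mem[OF that] by (auto simp: case_prod_beta)
  have "set es = (!) es ` {..<length es}" by (auto simp: set_conv_nth)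
  then have E: "?E = ?e ` {..<length es}" by (simp add: image_image case_prod_beta)
  have inj: "inj_on ?e {..<length es}"
  proof (rule inj_onI)
    fix k l assume kl: "k \<in> {..<length es}" "l \<in> {..<length es}" "?e k = ?e l"
    have "v ` {fst (es ! k), snd (es ! k)} = v ` {fst (es ! l), snd (es ! l)}" using kl(3) by simp
    then have "{fst (es ! k), snd (es ! k)} = {fst (es ! l), snd (es ! l)}"
      using inj_on_image_eq_iff[OF v] bound kl(1,2) by (metis empty_subsetI insert_subset lessThan_iff)
    then have "map (\<lambda>(i, j). {i, j}) es ! k = map (\<lambda>(i, j). {i, j}) es ! l"
      using kl(1,2) by (simp add: case_prod_beta)
    then show "k = l" using nth_eq_iff_index_eq[OF dist] kl(1,2) by simp
  qed
  define idx where "idx B = {k \<in> {..<length es}. ?e k \<in> B}" for B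
  have B_eq: "?e ` idx B = B" if "B \<subseteq> ?E" for B
    using that unfolding E idx_def by auto
  show ?thesis
  proof (rule card_inj_on_le[of idx])
    show "inj_on idx (removals (?V, ?E) k)"
      by (rule inj_on_inverseI[of _ "image ?e"], rule B_eq) (simp add: removals_def)
    show "finite (removable n es k)" by (rule finite_removable)
    show "idx ` removals (?V, ?E) k \<subseteq> removable n es k"
    proof
      fix I assume "I \<in> idx ` removals (?V, ?E) k"
      then obtain B where B: "B \<subseteq> ?E" "card B = k" "ugraph_connected (?V, ?E - B)" "I = idx B"
        by (auto simp: removals_def)
      have "card (?e ` idx B) = card (idx B)"
        by (rule card_image[OF inj_on_subset[OF inj]]) (auto simp: idx_def)
      then have "card I = k" using B B_eq by simp
      moreover have "\<not> cut_indices es X \<subseteq> I" if X: "proper_part {..<n} X" for X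
      proof -
        have "proper_part ?V (v ` X)"
          using X inj_on_image_eq_iff[OF v, of X "{..<n}"] by (auto simp: proper_part_def)
        moreover have "?V \<noteq> {}" using \<open>0 < n\<close> by auto
        ultimately have "\<not> edge_cut ?E (v ` X) \<subseteq> B"
          using B(3) connected_Diff_iff_cut[OF simple] by blast
        then obtain e where e: "e \<in> edge_cut ?E (v ` X)" "e \<notin> B" by blast
        then obtain l where l: "l < length es" "e = ?e l" using edge_cut_subset[of ?E] unfolding E by blast
        have vX: "v i \<in> v ` X \<longleftrightarrow> i \<in> X" if "i < n" for i
          using inj_on_image_mem_iff[OF v, of i X] X that by (auto simp: proper_part_def)
        have "l \<in> cut_indices es X"
          using e(1) bound[OF l(1)] vX l(1) unfolding l(2) doubleton_in_edge_cut_iff cut_indices_def by auto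
        moreover have "l \<notin> I" using e(2) l(2) B(4) by (simp add: idx_def)
        ultimately show ?thesis by auto
      qed
      moreover have "I \<subseteq> {..<length es}" using B(4) by (auto simp: idx_def)
      ultimately show "I \<in> removable n es k" by (simp add: removable_def)
    qed
  qed
qed

section \<open>Cubic graphs on eight vertices\<close>

definition expanded_K33_edges :: "(nat \<times> nat) list" where
  "expanded_K33_edges = [(0, 1), (1, 2), (0, 2), (0, 3), (1, 4), (2, 5), (6, 3), (6, 4), (6, 5), (7, 3), (7, 4), (7, 5)]"

definition expanded_prism_edges :: "(nat \<times> nat) list" where
  "expanded_prism_edges = [(0, 1), (1, 2), (0, 2), (0, 3), (1, 4), (2, 5), (6, 7), (6, 3), (6, 4), (7, 4), (7, 5), (3, 5)]"

definition cube_edges :: "(nat \<times> nat) list" where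
  "cube_edges = [(0, 1), (1, 2), (2, 3), (3, 0), (0, 4), (1, 5), (2, 6), (3, 7), (4, 5), (6, 5), (6, 7), (4, 7)]"

definition wagner_edges_1 :: "(nat \<times> nat) list" where
  "wagner_edges_1 = [(0, 1), (1, 2), (2, 3), (3, 0), (0, 4), (1, 5), (2, 6), (3, 7), (4, 6), (4, 7), (5, 6), (5, 7)]"

text \<open>The same graph as \<open>wagner_edges_1\<close> after exchanging 1 with 3 and 5 with 7.
  Both labellings arise around a fixed 4-cycle, and evaluating both spares the relabelling.\<close>

definition wagner_edges_2 :: "(nat \<times> nat) list" where
  "wagner_edges_2 = [(0, 1), (1, 2), (2, 3), (3, 0), (0, 4), (1, 5), (2, 6), (3, 7), (4, 6), (4, 5), (7, 6), (7, 5)]"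

lemma count_expanded_K33_edges: "weighted_count (cut_vectors 8 expanded_K33_edges) (replicate 12 1) 5 \<le> 392"
  by code_simp

lemma count_expanded_prism_edges: "weighted_count (cut_vectors 8 expanded_prism_edges) (replicate 12 1) 5 \<le> 392"
  by code_simp

lemma count_cube_edges: "weighted_count (cut_vectors 8 cube_edges) (replicate 12 1) 5 \<le> 392"
  by code_simp

lemma count_wagner_edges_1: "weighted_count (cut_vectors 8 wagner_edges_1) (replicate 12 1) 5 \<le> 392"
  by code_simp

lemma count_wagner_edges_2: "weighted_count (cut_vectors 8 wagner_edges_2) (replicate 12 1) 5 \<le> 392"
  by code_simp

lemma subset_card_Suc_eq_remove:
  assumes "finite B" "A \<subseteq> B" "card B = Suc (card A)"
  obtains m where "m \<in> B" "A = B - {m}"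
proof -
  have "card (B - A) = 1" using assms by (simp add: card_Diff_subset finite_subset)
  then obtain m where "B - A = {m}" by (rule card_1_singletonE)
  then show ?thesis using that[of m] assms(2) by blast
qed

section \<open>Neighbourhoods in a 3-edge-connected cubic graph on eight vertices\<close>

locale cubic_graph_8 =
  fixes V :: "'a set" and E :: "'a set set"
  assumes three_connected_cubic: "three_connected_cubic V E" and card_V: "card V = 8"
begin

definition nbrs :: "'a \<Rightarrow> 'a set" where
  "nbrs x = {y. {x, y} \<in> E}"

lemma simple: "simple_ugraph (V, E)"
  using three_connected_cubic by (simp add: three_connected_cubic_def)

lemma finite_V: "finite V"
  using card_V by (metis card.infinite zero_neq_numeral)

lemma finite_E: "finite E"
  using finite_edges[OF simple] by simp

lemma edge_nbrs: "{x, y} \<in> E \<longleftrightarrow> y \<in> nbrs x"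
  by (simp add: nbrs_def)

lemma nbrs_sym: "y \<in> nbrs x \<longleftrightarrow> x \<in> nbrs y"
  by (simp add: nbrs_def insert_commute)

lemma nbrs_V: "y \<in> nbrs x \<Longrightarrow> y \<in> V"
  using simple by (auto simp: simple_ugraph_def nbrs_def)

lemma nbrs_irrefl: "x \<notin> nbrs x"
  using simple by (auto simp: simple_ugraph_def nbrs_def)

lemma nbrsD:
  assumes "y \<in> nbrs x" shows "y \<in> V" "y \<noteq> x" "x \<in> nbrs y"
  using assms nbrs_V[OF assms] nbrs_irrefl[of x] nbrs_sym[of y x] by auto

lemma finite_nbrs: "finite (nbrs x)"
  using nbrs_V finite_V by (meson finite_subset subsetI)

lemma card_nbrs: "x \<in> V \<Longrightarrow> card (nbrs x) = 3"
proof -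
  assume x: "x \<in> V"
  have "inj_on (\<lambda>y. {x, y}) (nbrs x)" by (auto intro!: inj_onI simp: doubleton_eq_iff)
  moreover have "(\<lambda>y. {x, y}) ` nbrs x = {e \<in> E. x \<in> e}"
  proof (intro set_eqI iffI)
    fix e assume e: "e \<in> {e \<in> E. x \<in> e}"
    then have "card e = 2" using simple by (auto simp: simple_ugraph_def)
    then obtain y where "e = {x, y}" using e by (auto simp: card_2_iff insert_commute)
    then show "e \<in> (\<lambda>y. {x, y}) ` nbrs x" using e by (auto simp: nbrs_def)
  qed (auto simp: nbrs_def)
  ultimately have "card (nbrs x) = card {e \<in> E. x \<in> e}" by (metis card_image)
  then show ?thesis using three_connected_cubic x by (simp add: three_connected_cubic_def)
qed

lemma card_E: "card E = 12"
proof -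
  have "24 = (\<Sum>v\<in>V. card {e \<in> E. v \<in> e})"
    using three_connected_cubic card_V by (simp add: three_connected_cubic_def)
  also have "\<dots> = (\<Sum>v\<in>V. \<Sum>e\<in>{e \<in> E. v \<in> e}. (1::nat))" by simp
  also have "\<dots> = (\<Sum>e\<in>E. \<Sum>v\<in>{v \<in> V. v \<in> e}. (1::nat))"
    using finite_V finite_E by (rule sum.swap_restrict)
  also have "\<dots> = (\<Sum>e\<in>E. 2)"
  proof (intro sum.cong refl)
    fix e assume "e \<in> E"
    then have "{v \<in> V. v \<in> e} = e" "card e = 2" using simple by (auto simp: simple_ugraph_def)
    then show "(\<Sum>v\<in>{v \<in> V. v \<in> e}. (1::nat)) = 2" by simp
  qed
  finally show ?thesis by simp
qed

lemma nbrs_eqI: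
  assumes "x \<in> V" "{a, b, c} \<subseteq> nbrs x" "distinct [a, b, c]"
  shows "nbrs x = {a, b, c}"
  using card_subset_eq[OF finite_nbrs assms(2)] card_nbrs[OF assms(1)] assms(3) by simp

lemma third_nbr:
  assumes "x \<in> V" "a \<in> nbrs x" "b \<in> nbrs x" "a \<noteq> b"
  obtains c where "nbrs x = {a, b, c}" "distinct [a, b, c]" "c \<in> V" "c \<noteq> x"
proof -
  have "card (nbrs x - {a, b}) = 1" using card_nbrs[OF assms(1)] assms by (simp add: card_Diff_subset)
  then obtain c where c: "nbrs x - {a, b} = {c}" by (rule card_1_singletonE)
  then have "nbrs x = {a, b, c}" "c \<noteq> a" "c \<noteq> b" using assms by blast+
  then show ?thesis using that[of c] nbrs_V[of c x] nbrs_irrefl[of x] assms by auto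
qed

lemma nbrs_within_four:
  assumes "x \<in> V" "nbrs x \<subseteq> {a, b, c, d}" "distinct [a, b, c, d]" "a \<in> nbrs x"
  shows "nbrs x = {a, c, d} \<or> nbrs x = {a, b, d} \<or> nbrs x = {a, b, c}"
proof -
  have "card {a, b, c, d} = Suc (card (nbrs x))" using card_nbrs[OF assms(1)] assms(3) by simp
  then obtain m where "m \<in> {a, b, c, d}" "nbrs x = {a, b, c, d} - {m}"
    using subset_card_Suc_eq_remove[OF _ assms(2)] by blast
  then show ?thesis using assms(3,4) by auto
qed

lemma nbrs_within_three:
  assumes "x \<in> V" "nbrs x \<subseteq> {a, b, c}" "distinct [a, b, c]"
  shows "nbrs x = {a, b, c}"
  using card_subset_eq[OF _ assms(2)] card_nbrs[OF assms(1)] assms(3) by simp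

text \<open>The form of 3-edge-connectivity that excludes small configurations: it suffices to cover
  the edges leaving \<open>S\<close> by two edges.\<close>

lemma no_small_edge_cut:
  assumes "\<And>x y. x \<in> S \<Longrightarrow> y \<in> nbrs x \<Longrightarrow> y \<notin> S \<Longrightarrow> {x, y} \<in> F" "finite F" "card F \<le> 2" "S \<subseteq> V" "S \<noteq> {}" "card S < 8"
  shows False
proof -
  have "edge_cut E S \<subseteq> F"
  proof
    fix e assume e: "e \<in> edge_cut E S"
    then have "card e = 2" using simple by (auto simp: simple_ugraph_def edge_cut_def)
    then obtain x y where "e = {x, y}" "x \<in> S" "y \<notin> S" using e by (auto simp: edge_cut_def card_2_iff)
    then show "e \<in> F" using assms(1) e by (auto simp: edge_cut_def nbrs_def)
  qed
  then have "card (edge_cut E S) \<le> card F" by (rule card_mono[OF assms(2)])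
  moreover have "proper_part V S" using assms(4-6) card_V by (auto simp: proper_part_def)
  then have "3 \<le> card (edge_cut E S)"
    using three_connected_cubic by (simp add: three_connected_cubic_def)
  ultimately show False using assms(3) by linarith
qed

text \<open>Only the presence of the listed edges has to be checked: eight distinct vertices exhaust
  \<open>V\<close>, and twelve distinct edges exhaust \<open>E\<close>.\<close>

lemma card_removals_le_labelling:
  assumes xs: "distinct xs" "set xs \<subseteq> V" "length xs = 8"
    and adj: "\<forall>(i, j)\<in>set es. {xs ! i, xs ! j} \<in> E"
    and es: "length es = 12" "distinct (map (\<lambda>(i, j). {i, j}) es)" "\<forall>(i, j)\<in>set es. i < 8 \<and> j < 8"
    and count: "weighted_count (cut_vectors 8 es) (replicate 12 1) 5 \<le> 392"
  shows "card (removals (V, E) 5) \<le> 392"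
proof -
  let ?v = "\<lambda>i. xs ! i" and ?F = "(\<lambda>(i, j). {xs ! i, xs ! j}) ` set es"
  have inj: "inj_on ?v {..<8}" using xs by (auto intro!: inj_onI simp: nth_eq_iff_index_eq)
  have V: "?v ` {..<8} = V"
  proof (rule card_subset_eq[OF finite_V])
    show "?v ` {..<8} \<subseteq> V" using xs by auto
    show "card (?v ` {..<8}) = card V" using card_image[OF inj] card_V by simp
  qed
  have "inj_on (\<lambda>(i, j). {xs ! i, xs ! j}) (set es)"
  proof (rule inj_onI)
    fix a b assume ab: "a \<in> set es" "b \<in> set es"
      "(case a of (i, j) \<Rightarrow> {xs ! i, xs ! j}) = (case b of (i, j) \<Rightarrow> {xs ! i, xs ! j})"
    obtain i j k l where ijkl: "a = (i, j)" "b = (k, l)" by (metis surj_pair)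
    have "?v ` {i, j} = ?v ` {k, l}" using ab(3) ijkl by simp
    moreover have "{i, j} \<subseteq> {..<8}" "{k, l} \<subseteq> {..<8}" using ab es(3) ijkl by auto
    ultimately have eq: "{i, j} = {k, l}" using inj_on_image_eq_iff[OF inj] by blast
    have "inj_on (\<lambda>(i, j). {i, j}) (set es)" using es(2) by (simp add: distinct_map)
    from inj_onD[OF this _ ab(1,2)] show "a = b" using eq ijkl by simp
  qed
  moreover have "card (set es) = 12" using es(1,2) by (simp add: distinct_map distinct_card)
  ultimately have "card ?F = 12" by (simp add: card_image)
  then have E: "?F = E" using adj card_E by (intro card_subset_eq[OF finite_E]) auto
  have "card (removals (?v ` {..<8}, ?F) 5) \<le> card (removable 8 es 5)"
    using simple V E by (intro card_removals_list_graph_le[OF inj es(3,2)]) auto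
  moreover have "int (card (removable 8 es 5)) \<le> 392"
    using card_removable[of 8 es 5] es(1,3) count by simp
  ultimately show ?thesis using V E by simp
qed

section \<open>Cubic graphs with a triangle\<close>

lemma no_diamond:
  assumes V: "a \<in> V" "b \<in> V" and a: "nbrs a = {b, c, p}" and b: "nbrs b = {a, c, p}" and "c \<noteq> p"
  shows False
proof -
  have nc: "a \<in> nbrs c" "b \<in> nbrs c" and np: "a \<in> nbrs p" "b \<in> nbrs p"
    using a b nbrs_sym[of a c] nbrs_sym[of b c] nbrs_sym[of a p] nbrs_sym[of b p] by auto
  have "a \<noteq> b" using a nbrs_irrefl by auto
  have V': "c \<in> V" "p \<in> V" using a nbrs_V by auto
  obtain r where r: "nbrs c = {a, b, r}" using third_nbr[OF V'(1) nc \<open>a \<noteq> b\<close>] by metis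
  obtain w where w: "nbrs p = {a, b, w}" using third_nbr[OF V'(2) np \<open>a \<noteq> b\<close>] by metis
  show False
  \<comment> \<open>Only \<open>c\<close> and \<open>p\<close> can have a neighbour outside the four
    vertices, and at most one each.\<close>
  proof (rule no_small_edge_cut[of "{a, b, c, p}" "{{c, r}, {p, w}}"])
    show "{x, y} \<in> {{c, r}, {p, w}}" if "x \<in> {a, b, c, p}" "y \<in> nbrs x" "y \<notin> {a, b, c, p}" for x y
      using that a b r w by auto
    show "card {{c, r}, {p, w}} \<le> 2" by (simp add: card_insert_if)
    show "card {a, b, c, p} < 8" by (simp add: card_insert_if)
  qed (use V V' in auto)
qed

text \<open>Bundled into a predicate so that permutations of the triangle, carried along to
  \<open>p\<close>, \<open>q\<close>, \<open>r\<close>, reduce the later six cases to one.\<close>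

definition triangle_labelling :: "'a \<Rightarrow> 'a \<Rightarrow> 'a \<Rightarrow> 'a \<Rightarrow> 'a \<Rightarrow> 'a \<Rightarrow> 'a \<Rightarrow> 'a \<Rightarrow> bool" where
  "triangle_labelling a b c p q r s t \<longleftrightarrow>
     distinct [a, b, c, p, q, r, s, t] \<and> {a, b, c, p, q, r, s, t} = V \<and>
     nbrs a = {b, c, p} \<and> nbrs b = {a, c, q} \<and> nbrs c = {a, b, r}"

lemma triangle_labellingD:
  assumes "triangle_labelling a b c p q r s t"
  shows "distinct [a, b, c, p, q, r, s, t]" "{a, b, c, p, q, r, s, t} = V"
    "nbrs a = {b, c, p}" "nbrs b = {a, c, q}" "nbrs c = {a, b, r}"
  using assms unfolding triangle_labelling_def by blast+

lemma triangle_labelling_swap: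
  assumes "triangle_labelling a b c p q r s t"
  shows "triangle_labelling b a c q p r s t" "triangle_labelling a c b p r q s t"
proof -
  note T = triangle_labellingD[OF assms]
  have "distinct [b, a, c, q, p, r, s, t]" "distinct [a, c, b, p, r, q, s, t]" using T(1) by auto
  moreover have "{b, a, c, q, p, r, s, t} = V" "{a, c, b, p, r, q, s, t} = V"
    unfolding T(2)[symmetric] by blast+
  moreover have "nbrs c = {b, a, r}" "nbrs a = {c, b, p}" using T(3,5) by blast+
  ultimately show "triangle_labelling b a c q p r s t" "triangle_labelling a c b p r q s t"
    using T unfolding triangle_labelling_def by blast+
qed

text \<open>\<open>b\<close>, \<open>s\<close> and \<open>t\<close> use up the degree of
  \<open>q\<close>, so the third neighbour of \<open>p\<close> must be \<open>r\<close>. The graph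
  is the prism with one vertex replaced by a triangle.\<close>

lemma removals_le_triangle_adjacent:
  assumes T: "triangle_labelling a b c p q r s t"
    and s: "nbrs s = {t, p, q}" and t: "nbrs t = {s, q, r}"
  shows "card (removals (V, E) 5) \<le> 392"
proof -
  note dist = triangle_labellingD(1)[OF T] and V = triangle_labellingD(2)[OF T]
    and abc = triangle_labellingD(3-5)[OF T]
  have q: "nbrs q = {b, s, t}"
    using dist V abc s t nbrs_sym[of b q] nbrs_sym[of s q] nbrs_sym[of t q]
    by (intro nbrs_eqI) auto
  have "y \<in> {a, s, r}" if "y \<in> nbrs p" for y
  proof -
    have "p \<notin> nbrs b" "p \<notin> nbrs c" "p \<notin> nbrs q" "p \<notin> nbrs t"
      unfolding abc q t using dist by auto
    then have "y \<noteq> b" "y \<noteq> c" "y \<noteq> q" "y \<noteq> t" using nbrsD(3)[OF that] by auto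
    moreover have "y \<in> {a, b, c, p, q, r, s, t}" using nbrsD(1)[OF that] V by simp
    ultimately show ?thesis using nbrsD(2)[OF that] by auto
  qed
  then have "nbrs p = {a, s, r}" using dist V by (intro nbrs_within_three) auto
  then have "{p, r} \<in> E" by (simp add: edge_nbrs)
  moreover have "{a, b} \<in> E" "{b, c} \<in> E" "{a, c} \<in> E" "{a, p} \<in> E" "{b, q} \<in> E" "{c, r} \<in> E"
    "{s, t} \<in> E" "{s, p} \<in> E" "{s, q} \<in> E" "{t, q} \<in> E" "{t, r} \<in> E"
    using abc s t by (auto simp: edge_nbrs)
  ultimately show ?thesis
    using dist V
    by (intro card_removals_le_labelling[OF _ _ _ _ _ _ _ count_expanded_prism_edges,
          of "[a, b, c, p, q, r, s, t]"])
      (simp_all add: expanded_prism_edges_def doubleton_eq_iff)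
qed

text \<open>If \<open>s\<close> and \<open>t\<close> both miss \<open>p\<close>, then
  \<open>p\<close> must be joined to \<open>q\<close> and \<open>r\<close>, and \<open>q\<close>
  gets a fourth neighbour.\<close>

lemma triangle_no_common_miss:
  assumes T: "triangle_labelling a b c p q r s t"
    and s: "nbrs s = {t, q, r}" and t: "nbrs t = {s, q, r}"
  shows False
proof -
  note dist = triangle_labellingD(1)[OF T] and V = triangle_labellingD(2)[OF T]
    and abc = triangle_labellingD(3-5)[OF T]
  have "y \<in> {a, q, r}" if "y \<in> nbrs p" for y
  proof -
    have "p \<notin> nbrs b" "p \<notin> nbrs c" "p \<notin> nbrs s" "p \<notin> nbrs t"
      unfolding abc s t using dist by auto
    then have "y \<noteq> b" "y \<noteq> c" "y \<noteq> s" "y \<noteq> t" using nbrsD(3)[OF that] by auto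
    moreover have "y \<in> {a, b, c, p, q, r, s, t}" using nbrsD(1)[OF that] V by simp
    ultimately show ?thesis using nbrsD(2)[OF that] by auto
  qed
  then have "nbrs p = {a, q, r}" using dist V by (intro nbrs_within_three) auto
  then have "q \<in> nbrs p" "q \<in> nbrs b" "q \<in> nbrs s" "q \<in> nbrs t" using abc s t by simp_all
  from this[THEN nbrsD(3)] have "{b, p, s, t} \<subseteq> nbrs q" by simp
  then have "card {b, p, s, t} \<le> card (nbrs q)" by (rule card_mono[OF finite_nbrs])
  moreover have "q \<in> V" using V by auto
  ultimately show False using card_nbrs[of q] dist by simp
qed

lemma removals_le_triangle:
  assumes "a \<in> V" "b \<in> nbrs a" "c \<in> nbrs a" "c \<in> nbrs b"
  shows "card (removals (V, E) 5) \<le> 392"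
proof -
  have abcV: "a \<in> V" "b \<in> V" "c \<in> V" using assms nbrs_V by auto
  have abc: "a \<noteq> b" "a \<noteq> c" "b \<noteq> c" using assms nbrs_irrefl by auto
  obtain p where p: "nbrs a = {b, c, p}" "distinct [b, c, p]" "p \<in> V" "p \<noteq> a"
    using third_nbr[of a b c] assms abcV abc by metis
  obtain q where q: "nbrs b = {a, c, q}" "distinct [a, c, q]" "q \<in> V" "q \<noteq> b"
    using third_nbr[of b a c] assms abcV abc nbrs_sym by metis
  obtain r where r: "nbrs c = {a, b, r}" "distinct [a, b, r]" "r \<in> V" "r \<noteq> c"
    using third_nbr[of c a b] assms abcV abc nbrs_sym by metis
  have "p \<noteq> q" using no_diamond[of a b c p] p q abcV by auto
  moreover have "p \<noteq> r"
    using no_diamond[of a c b p] p r abcV by (auto simp: insert_commute)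
  moreover have "q \<noteq> r"
    using no_diamond[of b c a q] q r abcV by (auto simp: insert_commute)
  ultimately have dist6: "distinct [a, b, c, p, q, r]" using p q r abc by auto
  let ?S = "{a, b, c, p, q, r}"
  have "card ?S = 6" using dist6 by simp
  then have "card (V - ?S) = 2" using abcV p q r card_V by (simp add: card_Diff_subset)
  then obtain s t where st: "V - ?S = {s, t}" "s \<noteq> t" by (auto simp: card_2_iff)
  then have "s \<in> V - ?S" "t \<in> V - ?S" by simp_all
  then have dist: "distinct [a, b, c, p, q, r, s, t]" using dist6 st(2) by auto
  have V: "{a, b, c, p, q, r, s, t} = V" using st abcV p q r by blast
  have outside: "nbrs x \<subseteq> {p, q, r, s, t} - {x}" if "x \<in> {s, t}" for x
  proof
    fix y assume y: "y \<in> nbrs x"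
    have "x \<notin> nbrs a" "x \<notin> nbrs b" "x \<notin> nbrs c" unfolding p(1) q(1) r(1) using that dist by auto
    then have "y \<noteq> a" "y \<noteq> b" "y \<noteq> c" using nbrsD(3)[OF y] by auto
    moreover have "y \<in> {a, b, c, p, q, r, s, t}" using nbrsD(1)[OF y] V by simp
    ultimately show "y \<in> {p, q, r, s, t} - {x}" using nbrsD(2)[OF y] by simp
  qed
  have Vs: "s \<in> V" "t \<in> V" using V by auto
  show ?thesis
  proof (cases "t \<in> nbrs s")
    case False
    then have "s \<notin> nbrs t" using nbrsD(3) by blast
    \<comment> \<open>Both \<open>s\<close> and \<open>t\<close> are now joined to all of
      \<open>p\<close>, \<open>q\<close>, \<open>r\<close>: this is
      \<open>K\<^sub>3\<^sub>,\<^sub>3\<close> with one vertex replaced by a triangle.\<close>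
    have "nbrs s = {p, q, r}"
      using outside[of s] False dist by (intro nbrs_within_three[OF Vs(1)]) auto
    moreover have "nbrs t = {p, q, r}"
      using outside[of t] \<open>s \<notin> nbrs t\<close> dist by (intro nbrs_within_three[OF Vs(2)]) auto
    ultimately have "{a, b} \<in> E" "{b, c} \<in> E" "{a, c} \<in> E" "{a, p} \<in> E" "{b, q} \<in> E" "{c, r} \<in> E"
      "{s, p} \<in> E" "{s, q} \<in> E" "{s, r} \<in> E" "{t, p} \<in> E" "{t, q} \<in> E" "{t, r} \<in> E"
      using p(1) q(1) r(1) by (auto simp: edge_nbrs)
    then show ?thesis
      using dist V
      by (intro card_removals_le_labelling[OF _ _ _ _ _ _ _ count_expanded_K33_edges,
          of "[a, b, c, p, q, r, s, t]"])
      (simp_all add: expanded_K33_edges_def doubleton_eq_iff)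
  next
    case True
    then have ts: "s \<in> nbrs t" by (rule nbrsD)
    \<comment> \<open>Each of \<open>s\<close> and \<open>t\<close> misses exactly one of
      \<open>p\<close>, \<open>q\<close>, \<open>r\<close>, and not the same one. The six ordered
      pairs of missed vertices are permuted by the symmetries of the triangle.\<close>
    have s3: "nbrs s = {t, q, r} \<or> nbrs s = {t, p, r} \<or> nbrs s = {t, p, q}"
      using outside[of s] dist True by (intro nbrs_within_four[OF Vs(1)]) auto
    have t3: "nbrs t = {s, q, r} \<or> nbrs t = {s, p, r} \<or> nbrs t = {s, p, q}"
      using outside[of t] dist ts by (intro nbrs_within_four[OF Vs(2)]) auto
    have T: "triangle_labelling a b c p q r s t"
      using dist V p(1) q(1) r(1) unfolding triangle_labelling_def by blast
    note T' = triangle_labelling_swap[OF T]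
    note T'' = triangle_labelling_swap(2)[OF T'(1)] triangle_labelling_swap(1)[OF T'(2)]
    note T3 = triangle_labelling_swap(2)[OF T''(2)]
    have "\<not> (nbrs s = {t, q, r} \<and> nbrs t = {s, q, r})"
      using triangle_no_common_miss[OF T] by blast
    moreover have "\<not> (nbrs s = {t, p, r} \<and> nbrs t = {s, p, r})"
      using triangle_no_common_miss[OF T'(1)] by blast
    moreover have "\<not> (nbrs s = {t, p, q} \<and> nbrs t = {s, p, q})"
      using triangle_no_common_miss[OF T''(2)] by blast
    ultimately have "(nbrs s = {t, p, q} \<and> nbrs t = {s, q, r}) \<or> (nbrs s = {t, p, q} \<and> nbrs t = {s, p, r})
      \<or> (nbrs s = {t, p, r} \<and> nbrs t = {s, q, r}) \<or> (nbrs s = {t, p, r} \<and> nbrs t = {s, p, q})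
      \<or> (nbrs s = {t, q, r} \<and> nbrs t = {s, p, r}) \<or> (nbrs s = {t, q, r} \<and> nbrs t = {s, p, q})"
      using s3 t3 by argo
    then show ?thesis
    proof (elim disjE conjE, goal_cases)
      case 1
      then show ?thesis
        by (intro removals_le_triangle_adjacent[OF T]) (simp_all add: insert_commute)
    next
      case 2
      then show ?thesis
        by (intro removals_le_triangle_adjacent[OF T'(1)]) (simp_all add: insert_commute)
    next
      case 3
      then show ?thesis
        by (intro removals_le_triangle_adjacent[OF T'(2)]) (simp_all add: insert_commute)
    next
      case 4
      then show ?thesis
        by (intro removals_le_triangle_adjacent[OF T''(2)]) (simp_all add: insert_commute)
    next
      case 5
      then show ?thesis
        by (intro removals_le_triangle_adjacent[OF T''(1)]) (simp_all add: insert_commute)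
    next
      case 6
      then show ?thesis
        by (intro removals_le_triangle_adjacent[OF T3]) (simp_all add: insert_commute)
    qed
  qed
qed

end

section \<open>Triangle-free cubic graphs\<close>

locale triangle_free_cubic_graph_8 = cubic_graph_8 +
  assumes triangle_free: "y \<in> nbrs x \<Longrightarrow> z \<in> nbrs x \<Longrightarrow> z \<notin> nbrs y"
begin

text \<open>Otherwise a vertex, its three neighbours and their six further neighbours would be ten
  distinct vertices.\<close>

lemma four_cycle:
  "\<exists>z p w q. p \<in> nbrs z \<and> q \<in> nbrs z \<and> p \<in> nbrs w \<and> q \<in> nbrs w \<and> z \<noteq> w \<and> p \<noteq> q"
proof (rule ccontr)
  assume none: "\<not> ?thesis"
  have no_cycle: "z = w" if "p \<in> nbrs z" "q \<in> nbrs z" "p \<in> nbrs w" "q \<in> nbrs w" "p \<noteq> q" for z w p q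
    using none that by blast
  have "V \<noteq> {}" using card_V by auto
  then obtain z where z: "z \<in> V" by auto
  obtain p q r where pqr: "nbrs z = {p, q, r}" "distinct [p, q, r]"
    using card_nbrs[OF z] by (auto simp: card_3_iff)
  have mem: "p \<in> nbrs z" "q \<in> nbrs z" "r \<in> nbrs z" using pqr by auto
  have card2: "card (nbrs k - {z}) = 2" if "k \<in> nbrs z" for k
    using card_nbrs[OF nbrsD(1)[OF that]] nbrsD(3)[OF that] finite_nbrs by simp
  have disj: "(nbrs k - {z}) \<inter> (nbrs l - {z}) = {}" if "k \<in> nbrs z" "l \<in> nbrs z" "k \<noteq> l" for k l
    using no_cycle[OF that(1,2) _ _ that(3)] nbrsD(3) by blast
  have disjD: "(nbrs k - {z}) \<inter> insert z (nbrs z) = {}" if "k \<in> nbrs z" for k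
    using triangle_free that by blast
  let ?A = "nbrs p - {z}" and ?B = "nbrs q - {z}" and ?C = "nbrs r - {z}" and ?D = "insert z (nbrs z)"
  have "card (?A \<union> ?B) = 4"
    using disj[OF mem(1,2)] pqr(2) card2 mem finite_nbrs by (subst card_Un_disjoint) auto
  moreover have "(?A \<union> ?B) \<inter> ?C = {}"
    using disj[OF mem(1,3)] disj[OF mem(2,3)] pqr(2) by auto
  ultimately have "card (?A \<union> ?B \<union> ?C) = 6"
    using card2[OF mem(3)] finite_nbrs by (subst card_Un_disjoint) auto
  moreover have "(?A \<union> ?B \<union> ?C) \<inter> ?D = {}"
    using disjD[OF mem(1)] disjD[OF mem(2)] disjD[OF mem(3)] by auto
  moreover have "card ?D = 4" using card_nbrs[OF z] finite_nbrs nbrs_irrefl by simp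
  ultimately have ten: "card (?A \<union> ?B \<union> ?C \<union> ?D) = 10"
    using finite_nbrs by (subst card_Un_disjoint) auto
  have "?A \<union> ?B \<union> ?C \<union> ?D \<subseteq> V" using nbrs_V z by auto
  from card_mono[OF finite_V this] show False unfolding ten card_V by simp
qed

text \<open>Let \<open>y\<close> and \<open>u\<close> be the third neighbours of \<open>p\<close>
  and \<open>q\<close>. If they coincide, six vertices are joined to the rest by at most two edges.
  If not, the eighth vertex is adjacent to \<open>r\<close>, \<open>y\<close> and \<open>u\<close>,
  and then \<open>y\<close> needs \<open>u\<close> as a neighbour, which closes a triangle.\<close>

lemma no_K23:
  assumes V: "z \<in> V" "w \<in> V" and "z \<noteq> w" and z: "nbrs z = {p, q, r}" and w: "nbrs w = {p, q, r}"
    and pqr: "distinct [p, q, r]"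
  shows False
proof -
  have mem: "z \<in> nbrs k" "w \<in> nbrs k" "k \<in> V" if "k \<in> {p, q, r}" for k
    using that z w nbrsD(3)[of k z] nbrsD(3)[of k w] nbrsD(1)[of k z] by auto
  have pz: "p \<in> nbrs z" "q \<in> nbrs z" "r \<in> nbrs z" using z by auto
  have indep: "q \<notin> nbrs p" "r \<notin> nbrs p" "p \<notin> nbrs q" "r \<notin> nbrs q" "p \<notin> nbrs r" "q \<notin> nbrs r"
    using triangle_free pz by blast+
  obtain y where y: "nbrs p = {z, w, y}" "distinct [z, w, y]" "y \<in> V" "y \<noteq> p"
    using third_nbr[of p z w] mem[of p] \<open>z \<noteq> w\<close> by auto
  obtain u where u: "nbrs q = {z, w, u}" "distinct [z, w, u]" "u \<in> V" "u \<noteq> q"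
    using third_nbr[of q z w] mem[of q] \<open>z \<noteq> w\<close> by auto
  obtain k where k: "nbrs r = {z, w, k}" "distinct [z, w, k]" "k \<in> V" "k \<noteq> r"
    using third_nbr[of r z w] mem[of r] \<open>z \<noteq> w\<close> by auto
  have yu: "y \<noteq> q" "y \<noteq> r" "u \<noteq> p" "u \<noteq> r" using indep y(1) u(1) by auto
  have zw: "z \<notin> {p, q, r}" "w \<notin> {p, q, r}" using z w nbrs_irrefl by metis+
  show False
  proof (cases "y = u")
    case True
    have "p \<in> nbrs y" "q \<in> nbrs y" "p \<noteq> q"
      using nbrsD(3)[of y p] nbrsD(3)[of u q] y(1) u(1) True pqr by auto
    then obtain l where l: "nbrs y = {p, q, l}"
      by (rule third_nbr[OF y(3)]) blast
    show False
    proof (rule no_small_edge_cut[of "{z, w, p, q, r, y}" "{{r, k}, {y, l}}"])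
      show "{a, b} \<in> {{r, k}, {y, l}}"
        if "a \<in> {z, w, p, q, r, y}" "b \<in> nbrs a" "b \<notin> {z, w, p, q, r, y}" for a b
        using that z w y(1) u(1) k(1) l True by auto
      show "card {{r, k}, {y, l}} \<le> 2" by (simp add: card_insert_if)
      show "card {z, w, p, q, r, y} < 8" by (simp add: card_insert_if)
    qed (use V mem y in auto)
  next
    case False
    have dist: "distinct [z, w, p, q, r, y, u]" using False yu zw y u pqr \<open>z \<noteq> w\<close> by auto
    have "{z, w, p, q, r, y, u} \<subseteq> V" using V mem y u by auto
    moreover have "card {z, w, p, q, r, y, u} = 7" using dist by simp
    ultimately have "card (V - {z, w, p, q, r, y, u}) = 1" using card_V by (simp add: card_Diff_subset)
    then obtain t where t: "V - {z, w, p, q, r, y, u} = {t}" by (rule card_1_singletonE)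
    then have t': "t \<in> V" "t \<notin> {z, w, p, q, r, y, u}" by blast+
    have V_eq: "V \<subseteq> {z, w, p, q, r, y, u, t}" using t by blast
    have "nbrs t \<subseteq> {r, y, u}"
    proof
      fix b assume b: "b \<in> nbrs t"
      have "t \<notin> nbrs z" "t \<notin> nbrs w" "t \<notin> nbrs p" "t \<notin> nbrs q" unfolding z w y(1) u(1) using t'(2) by auto
      then have "b \<noteq> z" "b \<noteq> w" "b \<noteq> p" "b \<noteq> q" using nbrsD(3)[OF b] by auto
      moreover have "b \<in> {z, w, p, q, r, y, u, t}" using nbrsD(1)[OF b] V_eq by blast
      ultimately show "b \<in> {r, y, u}" using nbrsD(2)[OF b] by auto
    qed
    then have nt: "nbrs t = {r, y, u}" using dist t'(1) by (intro nbrs_within_three) auto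
    then have "t \<in> nbrs r" using nbrsD(3)[of r t] by simp
    then have "k = t" using k(1) t'(2) by auto
    have "nbrs y \<subseteq> {p, u, t}"
    proof
      fix b assume b: "b \<in> nbrs y"
      have "y \<notin> nbrs z" "y \<notin> nbrs w" "y \<notin> nbrs q" "y \<notin> nbrs r"
        unfolding z w u(1) k(1) \<open>k = t\<close> using dist t'(2) by auto
      then have "b \<noteq> z" "b \<noteq> w" "b \<noteq> q" "b \<noteq> r" using nbrsD(3)[OF b] by auto
      moreover have "b \<in> {z, w, p, q, r, y, u, t}" using nbrsD(1)[OF b] V_eq by blast
      ultimately show "b \<in> {p, u, t}" using nbrsD(2)[OF b] by auto
    qed
    then have "nbrs y = {p, u, t}" using dist t'(2) y(3) by (intro nbrs_within_three) auto
    then show False using triangle_free[of y t u] nt by simp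
  qed
qed

text \<open>The outer neighbours \<open>r\<close>, \<open>y\<close>, \<open>x\<close>,
  \<open>u\<close> of a 4-cycle \<open>z p w q\<close> are distinct, so they complete the vertex
  set, and they span a 4-cycle themselves. If it follows the order of the inner cycle, the graph is
  the cube; each of the two other orders gives the Wagner graph.\<close>

lemma removals_le_triangle_free: "card (removals (V, E) 5) \<le> 392"
proof -
  obtain z p w q where "p \<in> nbrs z" "q \<in> nbrs z" "p \<in> nbrs w" "q \<in> nbrs w" and ne: "z \<noteq> w" "p \<noteq> q"
    using four_cycle by blast
  then have cyc: "z \<in> V" "w \<in> V" "p \<in> nbrs z" "q \<in> nbrs z" "p \<in> nbrs w" "q \<in> nbrs w"
    using nbrsD(1)[OF nbrsD(3)] by blast+
  have pqV: "p \<in> V" "q \<in> V" and sym: "z \<in> nbrs p" "z \<in> nbrs q" "w \<in> nbrs p" "w \<in> nbrs q"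
    using nbrsD[OF cyc(3)] nbrsD[OF cyc(4)] nbrsD[OF cyc(5)] nbrsD[OF cyc(6)] by auto
  obtain r where r: "nbrs z = {p, q, r}" "distinct [p, q, r]" "r \<in> V" "r \<noteq> z"
    using third_nbr[OF cyc(1,3,4) ne(2)] by auto
  obtain x where x: "nbrs w = {p, q, x}" "distinct [p, q, x]" "x \<in> V" "x \<noteq> w"
    using third_nbr[OF cyc(2,5,6) ne(2)] by auto
  obtain y where y: "nbrs p = {z, w, y}" "distinct [z, w, y]" "y \<in> V" "y \<noteq> p"
    using third_nbr[OF pqV(1) sym(1,3) ne(1)] by auto
  obtain u where u: "nbrs q = {z, w, u}" "distinct [z, w, u]" "u \<in> V" "u \<noteq> q"
    using third_nbr[OF pqV(2) sym(2,4) ne(1)] by auto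
  have "r \<noteq> x" using no_K23[of z w p q r] cyc ne r x by auto
  moreover have "y \<noteq> u" using no_K23[of p q z w y] pqV ne y u by auto
  moreover have "r \<noteq> y" "r \<noteq> w" using triangle_free[of p z r] r(1) y(1) by auto
  moreover have "r \<noteq> u" using triangle_free[of q z r] r(1) u(1) by auto
  moreover have "x \<noteq> y" "x \<noteq> z" using triangle_free[of p w x] x(1) y(1) by auto
  moreover have "x \<noteq> u" using triangle_free[of q w x] x(1) u(1) by auto
  moreover have "y \<noteq> q" using triangle_free[of z p y] y(1) r(1) by auto
  moreover have "u \<noteq> p" using triangle_free[of z q u] u(1) r(1) by auto
  moreover have "p \<noteq> z" "q \<noteq> z" "p \<noteq> w" "q \<noteq> w"
    using nbrsD(2)[OF cyc(3)] nbrsD(2)[OF cyc(4)] nbrsD(2)[OF cyc(5)] nbrsD(2)[OF cyc(6)] by auto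
  ultimately have dist: "distinct [z, p, w, q, r, y, x, u]" using ne r x y u by auto
  have sub: "{z, p, w, q, r, y, x, u} \<subseteq> V" using cyc pqV r x y u by auto
  have "card {z, p, w, q, r, y, x, u} = 8" using dist by simp
  then have V_eq: "{z, p, w, q, r, y, x, u} = V" using card_subset_eq[OF finite_V sub] card_V by simp
  have outer: "b \<in> {z, p, w, q, r, y, x, u}" "b \<noteq> a" "a \<in> nbrs b" if "b \<in> nbrs a" for a b
    using nbrsD[OF that] V_eq by auto
  have nr: "nbrs r \<subseteq> {z, x, y, u}"
  proof
    fix b assume b: "b \<in> nbrs r"
    have "r \<notin> nbrs p" "r \<notin> nbrs w" "r \<notin> nbrs q" unfolding x(1) y(1) u(1) using dist by auto
    then have "b \<noteq> p" "b \<noteq> w" "b \<noteq> q" using outer(3)[OF b] by auto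
    then show "b \<in> {z, x, y, u}" using outer(1,2)[OF b] by auto
  qed
  have nx: "nbrs x \<subseteq> {w, r, y, u}"
  proof
    fix b assume b: "b \<in> nbrs x"
    have "x \<notin> nbrs z" "x \<notin> nbrs p" "x \<notin> nbrs q" unfolding r(1) y(1) u(1) using dist by auto
    then have "b \<noteq> z" "b \<noteq> p" "b \<noteq> q" using outer(3)[OF b] by auto
    then show "b \<in> {w, r, y, u}" using outer(1,2)[OF b] by auto
  qed
  have ny: "nbrs y \<subseteq> {p, r, x, u}"
  proof
    fix b assume b: "b \<in> nbrs y"
    have "y \<notin> nbrs z" "y \<notin> nbrs w" "y \<notin> nbrs q" unfolding r(1) x(1) u(1) using dist by auto
    then have "b \<noteq> z" "b \<noteq> w" "b \<noteq> q" using outer(3)[OF b] by auto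
    then show "b \<in> {p, r, x, u}" using outer(1,2)[OF b] by auto
  qed
  have nu: "nbrs u \<subseteq> {q, r, x, y}"
  proof
    fix b assume b: "b \<in> nbrs u"
    have "u \<notin> nbrs z" "u \<notin> nbrs w" "u \<notin> nbrs p" unfolding r(1) x(1) y(1) using dist by auto
    then have "b \<noteq> z" "b \<noteq> w" "b \<noteq> p" using outer(3)[OF b] by auto
    then show "b \<in> {q, r, x, y}" using outer(1,2)[OF b] by auto
  qed
  have cycle_edges: "{z, p} \<in> E" "{p, w} \<in> E" "{w, q} \<in> E" "{q, z} \<in> E"
    "{z, r} \<in> E" "{p, y} \<in> E" "{w, x} \<in> E" "{q, u} \<in> E"
    using r(1) x(1) y(1) u(1) by (simp_all add: edge_nbrs)
  have "z \<in> nbrs r" using r(1) by (intro nbrsD(3)[of r z]) simp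
  then have "nbrs r = {z, y, u} \<or> nbrs r = {z, x, u} \<or> nbrs r = {z, x, y}"
    using dist nr r(3) by (intro nbrs_within_four) auto
  then show ?thesis
  proof (elim disjE)
    assume r': "nbrs r = {z, y, u}"
    then have "x \<notin> nbrs r" using dist by auto
    then have "r \<notin> nbrs x" using nbrsD(3)[of r x] by blast
    then have "nbrs x = {w, y, u}" using nx dist x(3) by (intro nbrs_within_three) auto
    then have "{r, y} \<in> E" "{x, y} \<in> E" "{x, u} \<in> E" "{r, u} \<in> E"
      using r' by (simp_all add: edge_nbrs)
    then show ?thesis using dist sub cycle_edges
      by (intro card_removals_le_labelling[OF _ _ _ _ _ _ _ count_cube_edges, of "[z, p, w, q, r, y, x, u]"])
        (simp_all add: cube_edges_def doubleton_eq_iff)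
  next
    assume r': "nbrs r = {z, x, u}"
    then have "y \<notin> nbrs r" using dist by auto
    then have "r \<notin> nbrs y" using nbrsD(3)[of r y] by blast
    then have "nbrs y = {p, x, u}" using ny dist y(3) by (intro nbrs_within_three) auto
    then have "{r, x} \<in> E" "{r, u} \<in> E" "{y, x} \<in> E" "{y, u} \<in> E"
      using r' by (simp_all add: edge_nbrs)
    then show ?thesis using dist sub cycle_edges
      by (intro card_removals_le_labelling[OF _ _ _ _ _ _ _ count_wagner_edges_1, of "[z, p, w, q, r, y, x, u]"])
        (simp_all add: wagner_edges_1_def doubleton_eq_iff)
  next
    assume r': "nbrs r = {z, x, y}"
    then have "u \<notin> nbrs r" using dist by auto
    then have "r \<notin> nbrs u" using nbrsD(3)[of r u] by blast
    then have "nbrs u = {q, x, y}" using nu dist u(3) by (intro nbrs_within_three) auto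
    then have "{r, x} \<in> E" "{r, y} \<in> E" "{u, x} \<in> E" "{u, y} \<in> E"
      using r' by (simp_all add: edge_nbrs)
    then show ?thesis using dist sub cycle_edges
      by (intro card_removals_le_labelling[OF _ _ _ _ _ _ _ count_wagner_edges_2, of "[z, p, w, q, r, y, x, u]"])
        (simp_all add: wagner_edges_2_def doubleton_eq_iff)
  qed
qed

end

theorem card_removals_three_connected_cubic_8:
  assumes "three_connected_cubic V E" "card V = 8"
  shows "card (removals (V, E) 5) \<le> 392"
proof -
  interpret cubic_graph_8 V E by unfold_locales (use assms in auto)
  show ?thesis
  proof (cases "\<forall>x y z. y \<in> nbrs x \<longrightarrow> z \<in> nbrs x \<longrightarrow> z \<notin> nbrs y")
    case True
    then interpret triangle_free_cubic_graph_8 V E by unfold_locales blast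
    show ?thesis by (rule removals_le_triangle_free)
  next
    case False
    then obtain x y z where "y \<in> nbrs x" "z \<in> nbrs x" "z \<in> nbrs y" by blast
    then show ?thesis using removals_le_triangle[of x y z] nbrsD(1)[OF nbrsD(3)] by blast
  qed
qed

section \<open>Subdivisions\<close>

text \<open>\<open>c\<close> gives the position of the base edge on whose path an edge lies. Only
  what bounds the number of removals from below is recorded: the corank, the path lengths, and that
  one edge may be removed from each path of a removable set. Natural numbers as vertices keep a
  fresh one available.\<close>

definition subdivision :: "nat \<Rightarrow> (nat \<times> nat) list \<Rightarrow> (nat \<Rightarrow> nat) \<Rightarrow> nat set \<Rightarrow> nat set set \<Rightarrow> (nat set \<Rightarrow> nat) \<Rightarrow> bool" where
  "subdivision n es l V E c \<longleftrightarrow> simple_ugraph (V, E) \<and> V \<noteq> {} \<and> card E + n = card V + length es \<and>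
     c ` E \<subseteq> {..<length es} \<and> (\<forall>i<length es. card {e \<in> E. c e = i} = l i) \<and>
     (\<forall>D k. D \<subseteq> E \<longrightarrow> inj_on c D \<longrightarrow> c ` D \<in> removable n es k \<longrightarrow> ugraph_connected (V, E - D))"

lemma subdivision_trivial:
  assumes "0 < n" and es: "\<forall>(i, j)\<in>set es. i < n \<and> j < n \<and> i \<noteq> j"
    and dist: "distinct (map (\<lambda>(i, j). {i, j}) es)"
  shows "\<exists>V E c. subdivision n es (\<lambda>_. 1) V E c"
proof -
  let ?e = "\<lambda>k. {fst (es ! k), snd (es ! k)}"
  let ?E = "?e ` {..<length es}"
  let ?c = "inv_into {..<length es} ?e"
  have bound: "fst (es ! k) < n" "snd (es ! k) < n" "fst (es ! k) \<noteq> snd (es ! k)" if "k < length es" for k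
    using es nth_mem[OF that] by (auto simp: case_prod_beta)
  have inj: "inj_on ?e {..<length es}"
  proof (rule inj_onI)
    fix k l assume kl: "k \<in> {..<length es}" "l \<in> {..<length es}" "?e k = ?e l"
    then have "map (\<lambda>(i, j). {i, j}) es ! k = map (\<lambda>(i, j). {i, j}) es ! l"
      by (simp add: case_prod_beta)
    then show "k = l" using nth_eq_iff_index_eq[OF dist] kl(1,2) by simp
  qed
  have c_e: "?c (?e k) = k" if "k < length es" for k
    using inv_into_f_f[OF inj] that by simp
  have simple: "simple_ugraph ({..<n}, ?E)"
    using bound by (auto simp: simple_ugraph_def)
  have "card {e \<in> ?E. ?c e = i} = 1" if "i < length es" for i
  proof -
    have "{e \<in> ?E. ?c e = i} = {?e i}" using c_e that by auto
    then show ?thesis by simp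
  qed
  moreover have "ugraph_connected ({..<n}, ?E - D)"
    if D: "D \<subseteq> ?E" "?c ` D \<in> removable n es k" for D k
  proof -
    have "\<not> edge_cut ?E X \<subseteq> D" if X: "proper_part {..<n} X" for X
    proof -
      obtain j where j: "j \<in> cut_indices es X" "j \<notin> ?c ` D"
        using D(2) X unfolding removable_def by blast
      then have len: "j < length es" by (simp add: cut_indices_def)
      have "?e j \<in> ?E" using len by (intro imageI) simp
      then have "?e j \<in> edge_cut ?E X"
        using j(1) unfolding cut_indices_def doubleton_in_edge_cut_iff by blast
      moreover have "?e j \<notin> D"
      proof
        assume "?e j \<in> D"
        then have "?c (?e j) \<in> ?c ` D" by (rule imageI)
        then show False using c_e[OF len] j(2) by simp
      qed
      ultimately show ?thesis by blast
    qed
    then show ?thesis using connected_Diff_iff_cut[OF simple] \<open>0 < n\<close> by blast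
  qed
  moreover have "?c ` ?E \<subseteq> {..<length es}" using c_e by auto
  moreover have "card ?E = length es" using card_image[OF inj] by simp
  ultimately have "subdivision n es (\<lambda>_. 1) {..<n} ?E ?c"
    using simple \<open>0 < n\<close> by (auto simp: subdivision_def)
  then show ?thesis by blast
qed

text \<open>One edge of class \<open>i\<close> is replaced by two edges through a fresh
  vertex.\<close>

lemma subdivision_step:
  assumes sub: "subdivision n es l V E c" and i: "i < length es" "0 < l i"
  shows "\<exists>V' E' c'. subdivision n es (l(i := Suc (l i))) V' E' c'"
proof -
  have simple: "simple_ugraph (V, E)" and "V \<noteq> {}" and card: "card E + n = card V + length es"
    and cE: "c ` E \<subseteq> {..<length es}" and sizes: "\<And>j. j < length es \<Longrightarrow> card {e \<in> E. c e = j} = l j"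
    and conn: "\<And>D k. D \<subseteq> E \<Longrightarrow> inj_on c D \<Longrightarrow> c ` D \<in> removable n es k \<Longrightarrow> ugraph_connected (V, E - D)"
    using sub unfolding subdivision_def by blast+
  have finV: "finite V" and finE: "finite E"
    using simple finite_edges[OF simple] by (auto simp: simple_ugraph_def)
  have "{e \<in> E. c e = i} \<noteq> {}" using sizes[OF i(1)] i(2) by (metis card.empty less_irrefl)
  then obtain e where e: "e \<in> E" "c e = i" by auto
  then have "card e = 2" "e \<subseteq> V" using simple by (auto simp: simple_ugraph_def)
  then obtain u v where uv: "e = {u, v}" "u \<noteq> v" "u \<in> V" "v \<in> V" by (auto simp: card_2_iff)
  obtain w where w: "w \<notin> V" using finV ex_new_if_finite infinite_UNIV_nat by blast
  define e1 e2 where "e1 = {u, w}" and "e2 = {w, v}"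
  define E' where "E' = insert e1 (insert e2 (E - {e}))"
  define c' where "c' = c(e1 := i, e2 := i)"
  have wE: "w \<notin> f" if "f \<in> E" for f using that simple w by (auto simp: simple_ugraph_def)
  have new: "e1 \<notin> E" "e2 \<notin> E" "e1 \<noteq> e2"
    using wE uv by (auto simp: e1_def e2_def doubleton_eq_iff)
  have c'_old: "c' f = c f" if "f \<in> E" for f using that new by (auto simp: c'_def)
  have c'_new: "c' e1 = i" "c' e2 = i" by (simp_all add: c'_def)
  have simple': "simple_ugraph (insert w V, E')"
    using simple uv w by (auto simp: simple_ugraph_def E'_def e1_def e2_def card_insert_if)
  have "card (E - {e}) = card E - 1" "0 < card E" using e(1) finE by (auto simp: card_gt_0_iff)
  then have "card E' = Suc (card E)" using new finE by (simp add: E'_def)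
  then have "card E' + n = card (insert w V) + length es" using card w finV by simp
  moreover have "c' ` E' \<subseteq> {..<length es}"
    using cE i(1) c'_old c'_new by (auto simp: E'_def)
  moreover have "card {f \<in> E'. c' f = j} = (l(i := Suc (l i))) j" if "j < length es" for j
  proof (cases "j = i")
    case True
    have "{f \<in> E'. c' f = j} = insert e1 (insert e2 ({f \<in> E. c f = i} - {e}))"
      using c'_old c'_new True by (auto simp: E'_def)
    moreover have "card ({f \<in> E. c f = i} - {e}) = l i - 1" using sizes[OF i(1)] e finE by simp
    ultimately show ?thesis using new finE True i(2) by simp
  next
    case False
    have "{f \<in> E'. c' f = j} = {f \<in> E. c f = j}"
      using c'_old c'_new False e by (auto simp: E'_def)
    then show ?thesis using sizes[OF that] False by simp
  qed
  moreover have "ugraph_connected (insert w V, E' - D')"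
    if D': "D' \<subseteq> E'" "inj_on c' D'" "c' ` D' \<in> removable n es k" for D' k
  proof -
    \<comment> \<open>The removal before the step that corresponds to \<open>D'\<close>: either half
      of \<open>e\<close> stands for \<open>e\<close>.\<close>
    define D where "D = (D' - {e1, e2}) \<union> (if e1 \<in> D' \<or> e2 \<in> D' then {e} else {})"
    have not_both: "\<not> (e1 \<in> D' \<and> e2 \<in> D')" using D'(2) c'_new new(3) by (metis inj_onD)
    have DE: "D \<subseteq> E" using D'(1) e(1) by (auto simp: D_def E'_def)
    have e_D: "e \<in> D \<longleftrightarrow> e1 \<in> D' \<or> e2 \<in> D'" using D'(1) new e(1) by (auto simp: D_def E'_def)
    define h where "h f = (if f = e1 \<or> f = e2 then e else f)" for f
    have D_h: "D = h ` D'" by (auto simp: D_def h_def)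
    have c_h: "c (h f) = c' f" if "f \<in> D'" for f
      using that D'(1) c'_old c'_new e(2) by (auto simp: h_def E'_def)
    have "c ` D = c' ` D'" unfolding D_h image_image using c_h by simp
    moreover have "inj_on c D"
      unfolding D_h by (rule inj_onI) (use c_h D'(2) in \<open>auto dest: inj_onD\<close>)
    ultimately have conD: "ugraph_connected (V, E - D)" using conn DE D'(3) by simp
    have "\<not> edge_cut E' S' \<subseteq> D'" if S': "proper_part (insert w V) S'" for S'
    proof (cases "proper_part V (S' \<inter> V)")
      case True
      then obtain f where f: "f \<in> edge_cut E (S' \<inter> V)" "f \<notin> D"
        using conD connected_Diff_iff_cut[OF simple \<open>V \<noteq> {}\<close>] by blast
      then have fE: "f \<in> E" using edge_cut_subset by blast
      show ?thesis
      proof (cases "f = e")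
        case True
        then have nD: "e1 \<notin> D'" "e2 \<notin> D'" using f(2) e_D by auto
        have "u \<in> S' \<longleftrightarrow> v \<notin> S'"
          using f(1) uv unfolding True uv(1) doubleton_in_edge_cut_iff by auto
        then have "e1 \<in> edge_cut E' S' \<or> e2 \<in> edge_cut E' S'"
          unfolding e1_def e2_def doubleton_in_edge_cut_iff by (auto simp: E'_def e1_def e2_def)
        then show ?thesis using nD by blast
      next
        case False
        have "f \<subseteq> V" using fE simple by (auto simp: simple_ugraph_def)
        then have "f \<in> edge_cut E' S'" using f(1) fE False by (auto simp: edge_cut_def E'_def)
        moreover have "f \<notin> D'" using f(2) fE new by (auto simp: D_def)
        ultimately show ?thesis by blast
      qed
    next
      case False
      \<comment> \<open>Here the part only separates the new vertex from all old ones. Its cut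
        contains both halves of \<open>e\<close>, and injectivity of \<open>c'\<close> allows at
        most one of them in \<open>D'\<close>.\<close>
      then have "S' \<inter> V = {} \<or> V \<subseteq> S'" by (auto simp: proper_part_def)
      then have sep: "(u \<in> S' \<longleftrightarrow> w \<notin> S') \<and> (v \<in> S' \<longleftrightarrow> w \<notin> S')"
        using S' uv unfolding proper_part_def by blast
      then have "e1 \<in> edge_cut E' S'" "e2 \<in> edge_cut E' S'"
        unfolding e1_def e2_def doubleton_in_edge_cut_iff by (auto simp: E'_def e1_def e2_def)
      then show ?thesis using not_both by blast
    qed
    then show ?thesis using connected_Diff_iff_cut[OF simple'] by blast
  qed
  ultimately have "subdivision n es (l(i := Suc (l i))) (insert w V) E' c'"
    using simple' unfolding subdivision_def by blast
  then show ?thesis by blast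
qed

lemma subdivision_exists:
  assumes "0 < n" "\<forall>(i, j)\<in>set es. i < n \<and> j < n \<and> i \<noteq> j" "distinct (map (\<lambda>(i, j). {i, j}) es)"
    and "\<And>i. i < length es \<Longrightarrow> 0 < l i"
  shows "\<exists>V E c. subdivision n es l V E c"
  using assms(4)
proof (induction "\<Sum>i<length es. l i" arbitrary: l rule: less_induct)
  case less
  show ?case
  proof (cases "\<exists>i<length es. 1 < l i")
    case False
    then have one: "l i = 1" if "i < length es" for i using less.prems[OF that] that by force
    obtain V E c where "subdivision n es (\<lambda>_. 1) V E c" using subdivision_trivial[OF assms(1-3)] by blast
    then have "subdivision n es l V E c" using one by (simp add: subdivision_def)
    then show ?thesis by blast
  next
    case True
    then obtain i where i: "i < length es" "1 < l i" by auto
    let ?l = "l(i := l i - 1)"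
    have "(\<Sum>j<length es. ?l j) < (\<Sum>j<length es. l j)"
      using i by (intro sum_strict_mono_ex1) auto
    moreover have "0 < ?l j" if "j < length es" for j using less.prems[OF that] i by auto
    ultimately obtain V E c where "subdivision n es ?l V E c" using less.hyps[of ?l] by blast
    from subdivision_step[OF this i(1)] i(2) show ?thesis by simp
  qed
qed

lemma subdivision_card_edges:
  assumes "subdivision n es l V E c"
  shows "card E = (\<Sum>i<length es. l i)"
proof -
  have finE: "finite E" and cE: "c ` E \<subseteq> {..<length es}"
    and sizes: "\<And>j. j < length es \<Longrightarrow> card {e \<in> E. c e = j} = l j"
    using assms finite_edges[of "(V, E)"] by (auto simp: subdivision_def)
  have "(\<Sum>i<length es. l i) = (\<Sum>i<length es. \<Sum>e\<in>{e \<in> E. c e = i}. 1)"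
    using sizes by (intro sum.cong) auto
  also have "\<dots> = (\<Sum>e\<in>E. 1)" using finE cE by (intro sum.group) auto
  finally show ?thesis by simp
qed

text \<open>The counterpart of \<open>card_removals_le\<close> from below: transversals of the paths
  of a removable set are removals.\<close>

lemma card_removals_subdivision_ge:
  assumes "subdivision n es l V E c"
  shows "(\<Sum>I\<in>removable n es k. \<Prod>i\<in>I. l i) \<le> card (removals (V, E) k)"
proof -
  have finE: "finite E" and sizes: "\<And>j. j < length es \<Longrightarrow> card {e \<in> E. c e = j} = l j"
    and conn: "\<And>D k. D \<subseteq> E \<Longrightarrow> inj_on c D \<Longrightarrow> c ` D \<in> removable n es k \<Longrightarrow> ugraph_connected (V, E - D)"
    using assms finite_edges[of "(V, E)"] by (auto simp: subdivision_def)
  have "(\<Sum>I\<in>removable n es k. \<Prod>i\<in>I. l i) = (\<Sum>I\<in>removable n es k. \<Prod>i\<in>I. card {e \<in> E. c e = i})"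
    using sizes by (intro sum.cong prod.cong refl) (auto simp: removable_def)
  also have "\<dots> = card {D. D \<subseteq> E \<and> inj_on c D \<and> c ` D \<in> removable n es k}"
  proof (rule card_transversals_of_family[symmetric, OF finE finite_removable])
    show "finite I" if "I \<in> removable n es k" for I
      using that by (auto simp: removable_def intro: finite_subset)
  qed
  also have "\<dots> \<le> card (removals (V, E) k)"
  proof (rule card_mono)
    show "finite (removals (V, E) k)" using finE by (intro finite_removals) simp
    show "{D. D \<subseteq> E \<and> inj_on c D \<and> c ` D \<in> removable n es k} \<subseteq> removals (V, E) k"
    proof safe
      fix D assume D: "D \<subseteq> E" "inj_on c D" "c ` D \<in> removable n es k"
      then have "card D = k" using card_image[OF D(2)] by (simp add: removable_def)
      then show "D \<in> removals (V, E) k" using conn[OF D] D(1) by (simp add: removals_def)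
    qed
  qed
  finally show ?thesis .
qed

section \<open>The Wagner graph and its subdivisions\<close>

definition wagner_edges :: "(nat \<times> nat) list" where
  "wagner_edges = [(0, 1), (1, 2), (2, 3), (3, 4), (4, 5), (5, 6), (6, 7), (7, 0),
     (0, 4), (1, 5), (2, 6), (3, 7)]"

lemma length_wagner_edges: "length wagner_edges = 12"
  by (simp add: wagner_edges_def)

lemma wagner_edges_bound: "\<forall>(i, j)\<in>set wagner_edges. i < 8 \<and> j < 8 \<and> i \<noteq> j"
  by (simp add: wagner_edges_def)

lemma wagner_edges_bound': "\<forall>(i, j)\<in>set wagner_edges. i < 8 \<and> j < 8"
  by (simp add: wagner_edges_def)

lemma distinct_wagner_edges: "distinct (map (\<lambda>(i, j). {i, j}) wagner_edges)"
  by (simp add: wagner_edges_def doubleton_eq_iff)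

text \<open>The evaluated count 66 equals the number of all pairs of positions, so no pair can be
  missing.\<close>

lemma removable_wagner_pairs: "removable 8 wagner_edges 2 = {I. I \<subseteq> {..<12} \<and> card I = 2}"
proof (rule card_subset_eq)
  show "finite {I::nat set. I \<subseteq> {..<12} \<and> card I = 2}" by simp
  show "removable 8 wagner_edges 2 \<subseteq> {I. I \<subseteq> {..<12} \<and> card I = 2}"
    by (auto simp: removable_def length_wagner_edges)
  have "weighted_count (cut_vectors 8 wagner_edges) (replicate 12 1) 2 = 66" by code_simp
  then have "card (removable 8 wagner_edges 2) = 66"
    using card_removable[OF _ wagner_edges_bound', of 2] by (simp add: length_wagner_edges)
  then show "card (removable 8 wagner_edges 2) = card {I::nat set. I \<subseteq> {..<12} \<and> card I = 2}"
    by (simp add: n_subsets choose_two)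
qed

lemma removable_subset:
  assumes "I \<in> removable n es k" "J \<subseteq> I"
  shows "J \<in> removable n es (card J)"
  using assms unfolding removable_def by blast

lemma removable_wagner_le_2:
  assumes "I \<subseteq> {..<12}" "card I = k" "k \<le> 2"
  shows "I \<in> removable 8 wagner_edges k"
proof -
  have "card {..<12::nat} = 12" by simp
  then obtain J where "I \<subseteq> J" "J \<subseteq> {..<12}" "card J = 2"
    using exists_subset_between[of I 2 "{..<12}"] assms by auto
  then show ?thesis using removable_subset[of J 8 wagner_edges 2 I] assms(2) removable_wagner_pairs by auto
qed

text \<open>Supplies both competitors: the balanced one, compared at indices 1 and 2, and the one
  with long chords, compared at index 5.\<close>

lemma wagner_subdivision:
  fixes l :: "nat \<Rightarrow> nat"
  assumes l: "\<And>i. i < 12 \<Longrightarrow> 0 < l i" and sum: "(\<Sum>i<12. l i) = n + 4"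
  obtains H :: "nat ugraph" where "H \<in> conn_graphs n (n + 4)" "n + 4 \<le> card (removals H 1)"
    "(\<Sum>I | I \<subseteq> {..<12} \<and> card I = 2. \<Prod>i\<in>I. l i) \<le> card (removals H 2)"
    "(\<Sum>I\<in>removable 8 wagner_edges 5. \<Prod>i\<in>I. l i) \<le> card (removals H 5)"
proof -
  obtain V E c where sub: "subdivision 8 wagner_edges l V E c"
    using subdivision_exists[OF _ wagner_edges_bound distinct_wagner_edges, of l] l
    by (auto simp: length_wagner_edges)
  have cardE: "card E = n + 4"
    using subdivision_card_edges[OF sub] sum by (simp add: length_wagner_edges)
  have "card V = n" "simple_ugraph (V, E)"
    using sub cardE by (auto simp: subdivision_def length_wagner_edges)
  moreover have "{} \<in> removable 8 wagner_edges 0" by (rule removable_wagner_le_2) auto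
  then have "ugraph_connected (V, E - {})"
    using sub unfolding subdivision_def by (metis empty_subsetI image_empty inj_on_empty)
  ultimately have "(V, E) \<in> conn_graphs n (n + 4)" using cardE by (simp add: conn_graphs_def)
  moreover have "n + 4 \<le> card (removals (V, E) 1)"
  proof -
    have "removable 8 wagner_edges 1 = (\<lambda>i. {i}) ` {..<12}"
    proof
      show "removable 8 wagner_edges 1 \<subseteq> (\<lambda>i. {i}) ` {..<12}"
        by (auto simp: removable_def length_wagner_edges card_1_singleton_iff)
      show "(\<lambda>i. {i}) ` {..<12} \<subseteq> removable 8 wagner_edges 1"
        using removable_wagner_le_2[of _ 1] by auto
    qed
    then have "(\<Sum>I\<in>removable 8 wagner_edges 1. \<Prod>i\<in>I. l i) = (\<Sum>i<12. l i)"
      by (simp add: sum.reindex)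
    then show ?thesis using card_removals_subdivision_ge[OF sub, of 1] sum by simp
  qed
  ultimately show ?thesis
    using that card_removals_subdivision_ge[OF sub, of 2] card_removals_subdivision_ge[OF sub, of 5]
    unfolding removable_wagner_pairs by blast
qed

text \<open>The weights make the four chords of the 8-cycle longer than its edges in the ratio 22 to 19;
  with equal weights 20 the sum would only be \<open>392 * 20 ^ 5\<close>.\<close>

lemma sum_removable_wagner:
  "(\<Sum>I\<in>removable 8 wagner_edges 5. \<Prod>i\<in>I. if i < 8 then 19 else 22 :: nat) = 1258998368"
proof -
  let ?ws = "replicate 8 19 @ replicate 4 22 :: int list"
  have "weighted_count (cut_vectors 8 wagner_edges) ?ws 5 = 1258998368" by code_simp
  then have "(\<Sum>I\<in>removable 8 wagner_edges 5. \<Prod>i\<in>I. ?ws ! i) = 1258998368"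
    using sum_removable[OF _ wagner_edges_bound', of ?ws 5] by (simp add: length_wagner_edges)
  moreover have "(\<Prod>i\<in>I. ?ws ! i) = int (\<Prod>i\<in>I. if i < 8 then 19 else 22)"
    if "I \<in> removable 8 wagner_edges 5" for I
    unfolding of_nat_prod
  proof (rule prod.cong)
    fix i assume "i \<in> I"
    then have "i < 12" using that by (auto simp: removable_def length_wagner_edges)
    \<comment> \<open>In \<open>wagner_edges\<close> the positions 0 to 7 are the cycle edges and 8
      to 11 the chords.\<close>
    then show "?ws ! i = int (if i < 8 then 19 else 22)" by (auto simp: nth_append)
  qed simp
  ultimately have "int (\<Sum>I\<in>removable 8 wagner_edges 5. \<Prod>i\<in>I. if i < 8 then 19 else 22 :: nat) = 1258998368"
    by (simp add: of_nat_sum)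
  then show ?thesis by linarith
qed

section \<open>Uniformly most reliable graphs\<close>

lemma conn_graphs_finite_edges: "G \<in> conn_graphs n m \<Longrightarrow> finite (snd G)"
  by (rule finite_edges) (simp add: conn_graphs_def)

lemma removals_0:
  assumes "G \<in> conn_graphs n m"
  shows "removals G 0 = {{}}"
proof -
  have "finite (snd G)" "ugraph_connected G"
    using assms conn_graphs_finite_edges[OF assms] by (auto simp: conn_graphs_def)
  then show ?thesis by (auto simp: removals_def card_eq_0_iff dest: finite_subset)
qed

lemma removals_1_subset: "removals G 1 \<subseteq> (\<lambda>e. {e}) ` snd G"
  by (auto simp: removals_def card_1_singleton_iff)

text \<open>If all \<open>m\<close> single edges can be removed, none of them is a cut by
  itself.\<close>

lemma bridgeless_of_removals_1:
  assumes G: "(V, E) \<in> conn_graphs n m" and "m \<le> card (removals (V, E) 1)"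
  shows "bridgeless_graph V E"
proof
  have simple: "simple_ugraph (V, E)" and conn: "ugraph_connected (V, E)" and "card E = m"
    using G by (auto simp: conn_graphs_def)
  then show "simple_ugraph (V, E)" "V \<noteq> {}" by (auto simp: ugraph_connected_def)
  have finE: "finite E" using finite_edges[OF simple] by simp
  have "card ((\<lambda>e. {e}) ` E) = m" using \<open>card E = m\<close> by (subst card_image) auto
  then have singles: "removals (V, E) 1 = (\<lambda>e. {e}) ` E"
    using removals_1_subset[of "(V, E)"] assms(2) finE by (intro card_seteq) auto
  fix S assume S: "proper_part V S"
  show "2 \<le> card (edge_cut E S)"
  proof (rule ccontr)
    assume "\<not> 2 \<le> card (edge_cut E S)"
    moreover have "edge_cut E S \<noteq> {}" using conn S connected_iff_cut[OF simple] by blast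
    moreover have "finite (edge_cut E S)" using finite_subset[OF edge_cut_subset finE] .
    ultimately have "card (edge_cut E S) = 1" by (simp add: card_gt_0_iff Suc_leI le_antisym not_less_eq_eq numeral_2_eq_2)
    then obtain e where e: "edge_cut E S = {e}" by (rule card_1_singletonE)
    then have "e \<in> E" using edge_cut_subset by blast
    then have "{e} \<in> removals (V, E) 1" using singles by blast
    then have "ugraph_connected (V, E - {e})" by (simp add: removals_def)
    then show False using connected_Diff_iff_cut[OF simple \<open>V \<noteq> {}\<close>] S e by blast
  qed
qed

lemma umrg_removals_le:
  fixes G H :: "'a ugraph"
  assumes "umrg n (n + 4) G" "H \<in> conn_graphs n (n + 4)"
  shows "j \<le> n + 4 \<Longrightarrow> (\<And>k. k < j \<Longrightarrow> card (removals G k) = card (removals H k)) \<Longrightarrow>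
      card (removals H j) \<le> card (removals G j)"
    and "card (removals H 5) \<le> card (removals G 5)"
proof -
  have G: "G \<in> conn_graphs n (n + 4)" using assms(1) by (simp add: umrg_def)
  have fin: "finite (snd G)" "finite (snd H)" and card: "card (snd G) = n + 4" "card (snd H) = n + 4"
    using G assms(2) conn_graphs_finite_edges[OF G] conn_graphs_finite_edges[OF assms(2)]
    by (auto simp: conn_graphs_def)
  have le: "reliability H \<rho> \<le> reliability G \<rho>" if "\<rho> \<in> {0..1}" for \<rho>
    using assms that by (simp add: umrg_def)
  show "card (removals H j) \<le> card (removals G j)"
    if "j \<le> n + 4" "\<And>k. k < j \<Longrightarrow> card (removals G k) = card (removals H k)"
    using reliability_le_imp_removals_le_low[OF fin card le that] by simp
  have "fst G \<noteq> {}" "finite (fst G)" "card (fst G) = n"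
    using G by (auto simp: conn_graphs_def ugraph_connected_def simple_ugraph_def)
  \<comment> \<open>A connected graph has a vertex, so index 5 does not exceed the number of
    edges.\<close>
  then have "5 \<le> n + 4" by (cases n) auto
  then show "card (removals H 5) \<le> card (removals G 5)"
    using reliability_le_imp_removals_le_high[OF fin card le, of 5]
      removals_eq_empty[OF G] removals_eq_empty[OF assms(2)] by simp
qed

section \<open>Balanced and nearly balanced sums\<close>

lemma balanced_sum:
  fixes m :: nat
  defines "l \<equiv> \<lambda>i. m div 12 + (if i < m mod 12 then 1 else 0)"
  shows "(\<Sum>i<12. l i) = m" "12 * (\<Sum>i<12. (l i)\<^sup>2) \<le> m\<^sup>2 + 36"
proof -
  define q r where "q = m div 12" and "r = m mod 12"
  have m: "m = 12 * q + r" and r: "r < 12" by (simp_all add: q_def r_def)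
  have sum_ind: "(\<Sum>i<12. if i < r then x else 0) = r * x" for x :: nat
  proof -
    have "(\<Sum>i<12. if i < r then x else 0) = (\<Sum>i\<in>{..<12} \<inter> {i. i < r}. x)"
      by (subst sum.inter_restrict) auto
    also have "{..<12} \<inter> {i. i < r} = {..<r}" using r by auto
    finally show ?thesis by simp
  qed
  have l: "l i = q + (if i < r then 1 else 0)" for i by (simp add: l_def q_def r_def)
  show "(\<Sum>i<12. l i) = m" unfolding l sum.distrib sum_ind m by simp
  have "(l i)\<^sup>2 = q\<^sup>2 + (if i < r then 2 * q + 1 else 0)" for i
    unfolding l by (simp add: power2_eq_square algebra_simps)
  then have sum_sq: "(\<Sum>i<12. (l i)\<^sup>2) = 12 * q\<^sup>2 + r * (2 * q + 1)"
    unfolding sum.distrib sum_ind by (simp only: sum.distrib sum_ind) simp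
  \<comment> \<open>The constant 36 completes the square.\<close>
  have "int (m\<^sup>2 + 36) - int (12 * (12 * q\<^sup>2 + r * (2 * q + 1))) = (int r - 6)\<^sup>2"
    unfolding m by (simp add: power2_eq_square algebra_simps)
  then have "int (12 * (\<Sum>i<12. (l i)\<^sup>2)) \<le> int (m\<^sup>2 + 36)"
    unfolding sum_sq using zero_le_power2[of "int r - 6"] by linarith
  then show "12 * (\<Sum>i<12. (l i)\<^sup>2) \<le> m\<^sup>2 + 36" by linarith
qed

lemma near_balanced:
  fixes s :: "'a \<Rightarrow> nat"
  assumes "finite R" "card R \<le> 12" and sum: "(\<Sum>r\<in>R. s r) = m"
    and squares: "12 * (\<Sum>r\<in>R. (s r)\<^sup>2) \<le> m\<^sup>2 + 36" and "20 \<le> m"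
  shows "card R = 12" "\<And>r. r \<in> R \<Longrightarrow> 12 * s r \<le> m + 20"
proof -
  have sum': "(\<Sum>r\<in>R. real (s r)) = real m" using sum by (simp flip: of_nat_sum)
  have "real (12 * (\<Sum>r\<in>R. (s r)\<^sup>2)) \<le> real (m\<^sup>2 + 36)" using squares by (rule of_nat_mono)
  then have sq': "12 * (\<Sum>r\<in>R. (real (s r))\<^sup>2) \<le> (real m)\<^sup>2 + 36" by simp
  \<comment> \<open>With at most 11 classes the Cauchy-Schwarz inequality would give
    \<open>m\<^sup>2 \<le> 11 * 36 = 396\<close>; the bound \<open>20 \<le> m\<close> is chosen to
    exclude this.\<close>
  have m400: "400 \<le> (real m)\<^sup>2" using \<open>20 \<le> m\<close> power_mono[of 20 "real m" 2] by simp
  show c12: "card R = 12"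
  proof (rule ccontr)
    assume "card R \<noteq> 12"
    then have "real (card R) \<le> 11" using assms(2) by simp
    have "(real m)\<^sup>2 \<le> (\<Sum>r\<in>R. (real (s r))\<^sup>2) * real (card R)"
      using sum_squared_le_sum_of_squares[of "\<lambda>r. real (s r)" R] sum' by simp
    also have "\<dots> \<le> (\<Sum>r\<in>R. (real (s r))\<^sup>2) * 11"
      using \<open>real (card R) \<le> 11\<close> by (intro mult_left_mono sum_nonneg) auto
    finally show False using sq' m400 by linarith
  qed
  fix r assume r: "r \<in> R"
  have "(\<Sum>r\<in>R. (12 * real (s r) - real m)\<^sup>2) =
    144 * (\<Sum>r\<in>R. (real (s r))\<^sup>2) - 24 * real m * (\<Sum>r\<in>R. real (s r)) + 12 * (real m)\<^sup>2"
  proof -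
    have "(12 * x - real m)\<^sup>2 = 144 * x\<^sup>2 - 24 * real m * x + (real m)\<^sup>2" for x :: real
      by (simp add: power2_eq_square algebra_simps)
    then show ?thesis using c12 by (simp add: sum.distrib sum_subtractf flip: sum_distrib_left)
  qed
  \<comment> \<open>\<open>432 = 12 * 36\<close> is less than \<open>21\<^sup>2 = 441\<close>, so no
    deviation reaches 21.\<close>
  also have "\<dots> \<le> 432" using sq' unfolding sum' by (simp add: power2_eq_square)
  finally have "(\<Sum>r\<in>R. (12 * real (s r) - real m)\<^sup>2) \<le> 432" .
  moreover have "(12 * real (s r) - real m)\<^sup>2 \<le> (\<Sum>r\<in>R. (12 * real (s r) - real m)\<^sup>2)"
    using r assms(1) by (intro member_le_sum) auto
  ultimately have "(12 * real (s r) - real m)\<^sup>2 < 21\<^sup>2" by simp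
  then have "12 * real (s r) - real m < 21" by (rule power2_less_imp_less) simp
  then show "12 * s r \<le> m + 20" by linarith
qed

section \<open>The bound on the number of vertices\<close>

lemma umrg_card_lt:
  fixes G :: "nat ugraph"
  assumes umrg: "umrg n (n + 4) G"
  shows "n < 480000"
proof (rule ccontr)
  assume "\<not> n < 480000"
  define m where "m = n + 4"
  have m: "480000 \<le> m" using \<open>\<not> n < 480000\<close> by (simp add: m_def)
  obtain V E where VE: "G = (V, E)" by (cases G)
  have G: "(V, E) \<in> conn_graphs n (n + 4)" using umrg VE by (simp add: umrg_def)
  have cards: "card V = n" "card E = n + 4" using G by (auto simp: conn_graphs_def)

  \<comment> \<open>Near 0 the competitor is the balanced subdivision. It attains the largest
    possible number of single removals, so \<open>G\<close> must tie with it at index 1, and index 2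
    decides.\<close>
  define l where "l i = m div 12 + (if i < m mod 12 then 1 else 0)" for i
  have "0 < m div 12" using m by simp
  have l_sum: "(\<Sum>i<12. l i) = m" "12 * (\<Sum>i<12. (l i)\<^sup>2) \<le> m\<^sup>2 + 36"
    using balanced_sum[of m] unfolding l_def by auto
  obtain H1 :: "nat ugraph" where H1: "H1 \<in> conn_graphs n (n + 4)" "n + 4 \<le> card (removals H1 1)"
    "(\<Sum>I | I \<subseteq> {..<12} \<and> card I = 2. \<Prod>i\<in>I. l i) \<le> card (removals H1 2)"
    by (rule wagner_subdivision[of l n]) (use \<open>0 < m div 12\<close> l_sum in \<open>auto simp: l_def m_def\<close>)
  have r0: "card (removals G 0) = card (removals H1 0)"
    using removals_0[OF G] removals_0[OF H1(1)] VE by simp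
  have le1: "card (removals H1 1) \<le> card (removals G 1)"
    using umrg_removals_le(1)[OF umrg H1(1), of 1] r0 by simp
  have ub1: "card (removals K 1) \<le> n + 4" if K: "K \<in> conn_graphs n (n + 4)" for K :: "nat ugraph"
  proof -
    have "finite (snd K)" "card (snd K) = n + 4" 
      using K conn_graphs_finite_edges[OF K] by (auto simp: conn_graphs_def)
    then show ?thesis using surj_card_le[OF _ removals_1_subset[of K]] by simp
  qed
  have r1: "card (removals G 1) = card (removals H1 1)" "n + 4 \<le> card (removals G 1)"
    using ub1[OF G] le1 H1(2) VE by auto
  have le2: "card (removals H1 2) \<le> card (removals G 2)"
  proof (rule umrg_removals_le(1)[OF umrg H1(1)])
    show "card (removals G k) = card (removals H1 k)" if "k < 2" for k
      using that r0 r1(1) by (cases k) auto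
  qed simp
  interpret bridgeless_graph V E using bridgeless_of_removals_1[OF G] r1(2) VE by simp

  let ?R = "rep ` E"
  have finR: "finite ?R" using finite_E by simp
  have "(\<Sum>I | I \<subseteq> {..<12} \<and> card I = 2. \<Prod>i\<in>I. l i) \<le> card (removals (V, E) 2)"
    using H1(3) le2 VE by simp
  also have "\<dots> \<le> (\<Sum>B | B \<in> removals (V, E) 2 \<and> B \<subseteq> ?R. \<Prod>r\<in>B. class_size r)"
    by (rule card_removals_le)
  also have "\<dots> \<le> (\<Sum>B | B \<subseteq> ?R \<and> card B = 2. \<Prod>r\<in>B. class_size r)"
    using finR by (intro sum_mono2) (auto simp: removals_def)
  finally have "(\<Sum>I | I \<subseteq> {..<12} \<and> card I = 2. \<Prod>i\<in>I. l i) \<le>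
    (\<Sum>B | B \<subseteq> ?R \<and> card B = 2. \<Prod>r\<in>B. class_size r)" .
  moreover have class_sum: "(\<Sum>r\<in>?R. class_size r) = m"
    using sum_class_size cards by (simp add: m_def)
  \<comment> \<open>Both families of sizes have total \<open>m\<close>, so at least as many pairs
    means at most as large a sum of squares.\<close>
  ultimately have "(\<Sum>r\<in>?R. (class_size r)\<^sup>2) \<le> (\<Sum>i<12. (l i)\<^sup>2)"
    using square_of_sum_eq[OF finR, of class_size] square_of_sum_eq[of "{..<12}" l] l_sum(1) by simp
  then have squares: "12 * (\<Sum>r\<in>?R. (class_size r)\<^sup>2) \<le> m\<^sup>2 + 36" using l_sum(2) by linarith
  have "card ?R \<le> 12" using card_reps_le cards by simp
  note balanced = near_balanced[OF finR this class_sum squares]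
  have "card ?R = 12" using balanced(1) m by simp

  obtain P :: "nat set set" and F where PF: "three_connected_cubic P F" "card P = 8"
    "card {B \<in> removals (V, E) 5. B \<subseteq> ?R} \<le> card (removals (P, F) 5)"
    by (rule cubic_base[OF _ \<open>card ?R = 12\<close>]) (use cards in auto)
  \<comment> \<open>The unit for the unequal lengths:
    \<open>240 = 8 * 19 + 4 * 22 = 12 * 20\<close>.\<close>
  define u where "u = m div 240"
  have u: "2000 \<le> u" "240 * u \<le> m" "m < 240 * u + 240" using m by (auto simp: u_def)
  \<comment> \<open>\<open>m + 20\<close> is at most \<open>240 * u + 259\<close>, and
    \<open>259 < 12 * 22\<close>.\<close>
  have size: "class_size r \<le> 20 * u + 22" if "r \<in> ?R" for r
    using balanced(2)[OF _ that] u m by linarith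
  have "card (removals (V, E) 5) \<le> (\<Sum>B | B \<in> removals (V, E) 5 \<and> B \<subseteq> ?R. \<Prod>r\<in>B. class_size r)"
    by (rule card_removals_le)
  also have "\<dots> \<le> (\<Sum>B | B \<in> removals (V, E) 5 \<and> B \<subseteq> ?R. (20 * u + 22) ^ 5)"
  proof (rule sum_mono)
    fix B assume B: "B \<in> {B. B \<in> removals (V, E) 5 \<and> B \<subseteq> ?R}"
    have "(\<Prod>r\<in>B. class_size r) \<le> (\<Prod>r\<in>B. 20 * u + 22)"
      using B size by (intro prod_mono) auto
    then show "(\<Prod>r\<in>B. class_size r) \<le> (20 * u + 22) ^ 5" using B by (simp add: removals_def)
  qed
  also have "\<dots> \<le> 392 * (20 * u + 22) ^ 5"
    using PF(3) card_removals_three_connected_cubic_8[OF PF(1,2)] by simp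
  finally have upper: "card (removals G 5) \<le> 392 * (20 * u + 22) ^ 5" using VE by simp

  \<comment> \<open>The remainder modulo 240 is put on one cycle edge; extra length cannot decrease
    the sum.\<close>
  define l' where "l' i = (if i < 8 then 19 else 22) * u + (if i = 0 then m - 240 * u else 0)" for i :: nat
  have l'_sum: "(\<Sum>i<12. l' i) = n + 4"
  proof -
    have "{..<12} = {0, 1, 2, 3, 4, 5, 6, 7, 8, 9, 10, 11 :: nat}"
      by (simp add: set_eq_iff) presburger
    then show ?thesis using u(2) by (simp add: l'_def m_def)
  qed
  have l'_pos: "0 < l' i" if "i < 12" for i using u(1) by (simp add: l'_def)
  obtain H2 :: "nat ugraph" where H2: "H2 \<in> conn_graphs n (n + 4)"
    "(\<Sum>I\<in>removable 8 wagner_edges 5. \<Prod>i\<in>I. l' i) \<le> card (removals H2 5)"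
    by (rule wagner_subdivision[OF l'_pos l'_sum]) auto
  have "1258998368 * u ^ 5 = (\<Sum>I\<in>removable 8 wagner_edges 5. (\<Prod>i\<in>I. if i < 8 then 19 else 22) * u ^ 5)"
    unfolding sum_removable_wagner[symmetric] by (simp add: sum_distrib_right)
  also have "\<dots> = (\<Sum>I\<in>removable 8 wagner_edges 5. \<Prod>i\<in>I. (if i < 8 then 19 else 22) * u)"
    by (intro sum.cong refl) (auto simp: prod.distrib removable_def)
  also have "\<dots> \<le> (\<Sum>I\<in>removable 8 wagner_edges 5. \<Prod>i\<in>I. l' i)"
    by (intro sum_mono prod_mono) (auto simp: l'_def)
  also have "\<dots> \<le> card (removals H2 5)" by (rule H2(2))
  also have "\<dots> \<le> card (removals G 5)" by (rule umrg_removals_le(2)[OF umrg H2(1)])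
  also have "\<dots> \<le> 392 * (20 * u + 22) ^ 5" by (rule upper)
  finally have "real (1258998368 * u ^ 5) \<le> real (392 * (20 * u + 22) ^ 5)" by (rule of_nat_mono)
  then have "1258998368 * real u ^ 5 \<le> 392 * (20 * real u + 22) ^ 5" by simp
  \<comment> \<open>For \<open>u \<ge> 2000\<close> the summand 22 is at most
    \<open>11 / 1000 * u\<close>. After this \<open>u ^ 5\<close> cancels and a numerical comparison
    remains; the threshold is \<open>240 * 2000\<close>.\<close>
  also have "\<dots> \<le> 392 * (20011 / 1000 * real u) ^ 5"
    using u(1) by (intro mult_left_mono power_mono) auto
  also have "\<dots> = 392 * (20011 / 1000) ^ 5 * real u ^ 5" by (simp only: power_mult_distrib mult.assoc)
  finally have "1258998368 * real u ^ 5 \<le> 392 * (20011 / 1000) ^ 5 * real u ^ 5" .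
  then have "1258998368 \<le> 392 * (20011 / 1000 :: real) ^ 5"
    using u(1) by (subst (asm) mult_le_cancel_right_pos) auto
  then show False by (simp add: power_divide)
qed

section \<open>Isomorphism classes\<close>

lemma ugraph_iso_sym: "(G, H) \<in> ugraph_iso \<Longrightarrow> (H, G) \<in> ugraph_iso"
proof -
  assume "(G, H) \<in> ugraph_iso"
  then obtain f where f: "simple_ugraph G" "simple_ugraph H" "bij_betw f (fst G) (fst H)"
    "\<And>u v. u \<in> fst G \<Longrightarrow> v \<in> fst G \<Longrightarrow> {u, v} \<in> snd G \<longleftrightarrow> {f u, f v} \<in> snd H"
    unfolding ugraph_iso_def by blast
  let ?g = "inv_into (fst G) f"
  have g: "bij_betw ?g (fst H) (fst G)" using f(3) by (rule bij_betw_inv_into)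
  have "{u, v} \<in> snd H \<longleftrightarrow> {?g u, ?g v} \<in> snd G" if "u \<in> fst H" "v \<in> fst H" for u v
    using f(4)[of "?g u" "?g v"] that g bij_betw_inv_into_right[OF f(3)] by (auto simp: bij_betw_def)
  then show ?thesis using f(1,2) g unfolding ugraph_iso_def by blast
qed

lemma ugraph_iso_trans: "(G, H) \<in> ugraph_iso \<Longrightarrow> (H, K) \<in> ugraph_iso \<Longrightarrow> (G, K) \<in> ugraph_iso"
proof -
  assume "(G, H) \<in> ugraph_iso" "(H, K) \<in> ugraph_iso"
  then obtain f g where f: "simple_ugraph G" "simple_ugraph K" "bij_betw f (fst G) (fst H)"
    "\<And>u v. u \<in> fst G \<Longrightarrow> v \<in> fst G \<Longrightarrow> {u, v} \<in> snd G \<longleftrightarrow> {f u, f v} \<in> snd H"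
    and g: "bij_betw g (fst H) (fst K)"
    "\<And>u v. u \<in> fst H \<Longrightarrow> v \<in> fst H \<Longrightarrow> {u, v} \<in> snd H \<longleftrightarrow> {g u, g v} \<in> snd K"
    unfolding ugraph_iso_def by blast
  have "bij_betw (g \<circ> f) (fst G) (fst K)" using f(3) g(1) by (rule bij_betw_trans)
  moreover have "{u, v} \<in> snd G \<longleftrightarrow> {(g \<circ> f) u, (g \<circ> f) v} \<in> snd K" if "u \<in> fst G" "v \<in> fst G" for u v
    using f(4)[OF that] g(2)[of "f u" "f v"] bij_betwE[OF f(3)] that by auto
  ultimately show ?thesis using f(1,2) unfolding ugraph_iso_def by blast
qed

lemma ugraph_iso_initial_segment:
  assumes "simple_ugraph G" "card (fst G) = n"
  obtains H :: "nat ugraph" where "(G, H) \<in> ugraph_iso" "fst H = {..<n}" "snd H \<subseteq> Pow {..<n}"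
proof -
  obtain f where f: "bij_betw f (fst G) {..<n}"
    using assms finite_same_card_bij[of "fst G" "{..<n}"] by (auto simp: simple_ugraph_def)
  have inj: "inj_on f (fst G)" using f by (simp add: bij_betw_def)
  have edges: "e \<subseteq> fst G" "card e = 2" if "e \<in> snd G" for e
    using assms(1) that by (auto simp: simple_ugraph_def)
  let ?H = "({..<n}, image f ` snd G)"
  have img: "f ` e \<subseteq> {..<n}" if "e \<in> snd G" for e
    using edges(1)[OF that] f by (auto simp: bij_betw_def)
  have "card (f ` e) = 2" if "e \<in> snd G" for e
    using card_image[OF inj_on_subset[OF inj edges(1)[OF that]]] edges(2)[OF that] by simp
  then have "simple_ugraph ?H" using img by (auto simp: simple_ugraph_def)
  moreover have "{u, v} \<in> snd G \<longleftrightarrow> {f u, f v} \<in> snd ?H" if uv: "u \<in> fst G" "v \<in> fst G" for u v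
  proof
    assume "{f u, f v} \<in> snd ?H"
    then obtain e where e: "e \<in> snd G" "f ` e = f ` {u, v}" by auto
    then have "e = {u, v}" using inj_on_image_eq_iff[OF inj edges(1)[OF e(1)], of "{u, v}"] uv by simp
    then show "{u, v} \<in> snd G" using e by simp
  qed (auto intro: image_eqI[of _ _ "{u, v}"])
  ultimately have "(G, ?H) \<in> ugraph_iso" using assms(1) f unfolding ugraph_iso_def by auto
  then show ?thesis using that img by force
qed

theorem theorem4:
  "finite ({G :: nat ugraph. \<exists>n>0. umrg n (n + 4) G} // ugraph_iso)"
proof (rule finite_subset)
  let ?N = "480000 :: nat"
  \<comment> \<open>By the bound on \<open>n\<close>, every class in question has a member on an
    initial segment of bounded length, and such graphs are finite in number.\<close>
  let ?reps = "(\<Union>n<?N. {{..<n}} \<times> Pow (Pow {..<n})) :: nat ugraph set"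
  show "finite ((\<lambda>H. ugraph_iso `` {H}) ` ?reps)" by (intro finite_imageI finite_UN_I) auto
  show "{G :: nat ugraph. \<exists>n>0. umrg n (n + 4) G} // ugraph_iso \<subseteq> (\<lambda>H. ugraph_iso `` {H}) ` ?reps"
  proof
    fix C assume "C \<in> {G :: nat ugraph. \<exists>n>0. umrg n (n + 4) G} // ugraph_iso"
    then obtain G :: "nat ugraph" and n where G: "umrg n (n + 4) G" "C = ugraph_iso `` {G}"
      by (auto elim: quotientE)
    then have "simple_ugraph G" "card (fst G) = n" by (auto simp: umrg_def conn_graphs_def)
    then obtain H :: "nat ugraph" where H: "(G, H) \<in> ugraph_iso" "fst H = {..<n}" "snd H \<subseteq> Pow {..<n}"
      by (rule ugraph_iso_initial_segment)
    have "C = ugraph_iso `` {H}"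
      using G(2) H(1) ugraph_iso_sym ugraph_iso_trans by blast
    moreover have "H \<in> ?reps"
      using H(2,3) umrg_card_lt[OF G(1)] by (cases H) auto
    ultimately show "C \<in> (\<lambda>H. ugraph_iso `` {H}) ` ?reps" by (rule image_eqI)
  qed
qed

end
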